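(* Let $k$ be an algebraically closed field of characteristic $p>0$ and let $H$ be a finite-dimensional cocommutative connected Hopf algebra over $k$. Then for every $n\ge 0$, $$\Gamma^n(H)=\big(H^*/\Gamma_n(H^* )\big)^*\quad\text{and}\quad \Gamma_n(H^* )=\big(H/\Gamma^n(H)\big)^*.$$
   Context: Coradical filtration: $H_0$ is the sum of all simple subcoalgebras of $H$, $H_n=\Delta^{-1}(H\otimes H_{n-1}+H_0\otimes H)$ for $n\ge1$; $H$ is connected if $H_0$ is one-dimensional. $H^*$ is the dual Hopf algebra (commutative since $H$ is cocommutative), and $H$ is identified with $H^{**}$. Lower power series of the commutative Hopf algebra $H^*$: $\Gamma_n(H^* )=\{f^{p^n}:f\in H^*\}$. Upper power series of $H$: $\Gamma^0(H)=k$ and $\Gamma^n(H)$ is the subalgebra generated by $H_{p^{n-1}}$ for $n\ge 1$. For a normal Hopf subalgebra $K$ of a Hopf algebra $L$ (normal meaning $\sum S(l_1)kl_2\in K$ and $\sum l_1kS(l_2)\in K$ for $k\in K,l\in L$), $L/K$ denotes the quotient Hopf algebra $L/LK^+$, where $K^+=\ker\varepsilon|_K$. For a Hopf ideal $I$ of a finite-dimensional Hopf algebra $L$, $(L/I)^*$ is identified with the Hopf subalgebra $\{f\in L^*: f(I)=0\}$ of $L^*$. *)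

theory Defs
  imports "HOL-Computational_Algebra.Polynomial"
begin

text \<open>
  A finite-dimensional Hopf algebra H over a field 'k is encoded by its structure
  constants with respect to a basis (e_a) indexed by a finite type 'i.
  Elements of H are coordinate functions 'i \<Rightarrow> 'k; elements of H \<otimes> H are
  functions 'i \<times> 'i \<Rightarrow> 'k.
    e_a e_b = sum_c M a b c e_c,   1 = sum_c U c e_c,
    Delta(e_a) = sum_(b,c) D a b c e_b \<otimes> e_c,   eps(e_a) = E a,
    S(e_a) = sum_b A a b e_b.
  The dual Hopf algebra H^* is encoded w.r.t. the dual basis (e^a): its elements are
  again functions 'i \<Rightarrow> 'k, and the pairing is  <f,h> = sum_a f a * h a.
  Its structure constants are  M^* b c a = D a b c,  U^* = E,  D^* c a b = M a b c,
  E^* = U,  A^* a b = A b a.  With this the identification H = H^** is the identity.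
\<close>

definition kron :: "'i \<Rightarrow> 'i \<Rightarrow> 'k::field" where
  "kron a b = (if a = b then 1 else 0)"

definition hopf_sc ::
  "('i::finite \<Rightarrow> 'i \<Rightarrow> 'i \<Rightarrow> 'k::field) \<Rightarrow> ('i \<Rightarrow> 'k) \<Rightarrow>
   ('i \<Rightarrow> 'i \<Rightarrow> 'i \<Rightarrow> 'k) \<Rightarrow> ('i \<Rightarrow> 'k) \<Rightarrow> ('i \<Rightarrow> 'i \<Rightarrow> 'k) \<Rightarrow> bool" where
  "hopf_sc M U D E A \<longleftrightarrow>
     \<comment> \<open>associativity\<close>
     (\<forall>a b c d. (\<Sum>e\<in>UNIV. M a b e * M e c d) = (\<Sum>e\<in>UNIV. M b c e * M a e d)) \<and>
     \<comment> \<open>unit\<close>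
     (\<forall>b c. (\<Sum>a\<in>UNIV. U a * M a b c) = kron b c) \<and>
     (\<forall>a c. (\<Sum>b\<in>UNIV. U b * M a b c) = kron a c) \<and>
     \<comment> \<open>coassociativity\<close>
     (\<forall>a b c d. (\<Sum>e\<in>UNIV. D a e d * D e b c) = (\<Sum>e\<in>UNIV. D a b e * D e c d)) \<and>
     \<comment> \<open>counit\<close>
     (\<forall>a c. (\<Sum>b\<in>UNIV. E b * D a b c) = kron a c) \<and>
     (\<forall>a b. (\<Sum>c\<in>UNIV. D a b c * E c) = kron a b) \<and>
     \<comment> \<open>Delta is an algebra map\<close>
     (\<forall>a b d e. (\<Sum>c\<in>UNIV. M a b c * D c d e) =
        (\<Sum>d1\<in>UNIV. \<Sum>e1\<in>UNIV. \<Sum>d2\<in>UNIV. \<Sum>e2\<in>UNIV.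
            D a d1 e1 * D b d2 e2 * M d1 d2 d * M e1 e2 e)) \<and>
     (\<forall>d e. (\<Sum>c\<in>UNIV. U c * D c d e) = U d * U e) \<and>
     \<comment> \<open>epsilon is an algebra map\<close>
     (\<forall>a b. (\<Sum>c\<in>UNIV. M a b c * E c) = E a * E b) \<and>
     (\<Sum>c\<in>UNIV. U c * E c) = 1 \<and>
     \<comment> \<open>antipode: m (S \<otimes> id) Delta = eta eps = m (id \<otimes> S) Delta\<close>
     (\<forall>a d. (\<Sum>b\<in>UNIV. \<Sum>c\<in>UNIV. D a b c * (\<Sum>b'\<in>UNIV. A b b' * M b' c d)) = E a * U d) \<and>
     (\<forall>a d. (\<Sum>b\<in>UNIV. \<Sum>c\<in>UNIV. D a b c * (\<Sum>c'\<in>UNIV. A c c' * M b c' d)) = E a * U d)"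

definition cocommutative :: "('i \<Rightarrow> 'i \<Rightarrow> 'i \<Rightarrow> 'k) \<Rightarrow> bool" where
  "cocommutative D \<longleftrightarrow> (\<forall>a b c. D a b c = D a c b)"

definition dual_mult :: "('i \<Rightarrow> 'i \<Rightarrow> 'i \<Rightarrow> 'k) \<Rightarrow> ('i \<Rightarrow> 'i \<Rightarrow> 'i \<Rightarrow> 'k)" where
  "dual_mult D = (\<lambda>b c a. D a b c)"

definition hmul :: "('i::finite \<Rightarrow> 'i \<Rightarrow> 'i \<Rightarrow> 'k::field) \<Rightarrow> ('i \<Rightarrow> 'k) \<Rightarrow> ('i \<Rightarrow> 'k) \<Rightarrow> ('i \<Rightarrow> 'k)" where
  "hmul M x y = (\<lambda>c. \<Sum>a\<in>UNIV. \<Sum>b\<in>UNIV. x a * y b * M a b c)"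

definition hcomul :: "('i::finite \<Rightarrow> 'i \<Rightarrow> 'i \<Rightarrow> 'k::field) \<Rightarrow> ('i \<Rightarrow> 'k) \<Rightarrow> ('i \<times> 'i \<Rightarrow> 'k)" where
  "hcomul D x = (\<lambda>(b, c). \<Sum>a\<in>UNIV. x a * D a b c)"

definition hcounit :: "('i::finite \<Rightarrow> 'k::field) \<Rightarrow> ('i \<Rightarrow> 'k) \<Rightarrow> 'k" where
  "hcounit E x = (\<Sum>a\<in>UNIV. x a * E a)"

primrec hpow :: "('i::finite \<Rightarrow> 'i \<Rightarrow> 'i \<Rightarrow> 'k::field) \<Rightarrow> ('i \<Rightarrow> 'k) \<Rightarrow> ('i \<Rightarrow> 'k) \<Rightarrow> nat \<Rightarrow> ('i \<Rightarrow> 'k)" where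
  "hpow M U x 0 = U"
| "hpow M U x (Suc m) = hmul M (hpow M U x m) x"

definition pairing :: "('i::finite \<Rightarrow> 'k::field) \<Rightarrow> ('i \<Rightarrow> 'k) \<Rightarrow> 'k" where
  "pairing f h = (\<Sum>a\<in>UNIV. f a * h a)"

definition lsubspace :: "('x \<Rightarrow> 'k::field) set \<Rightarrow> bool" where
  "lsubspace V \<longleftrightarrow> (\<lambda>_. 0) \<in> V \<and> (\<forall>u\<in>V. \<forall>v\<in>V. (\<lambda>i. u i + v i) \<in> V)
      \<and> (\<forall>c. \<forall>v\<in>V. (\<lambda>i. c * v i) \<in> V)"

definition lspan :: "('x \<Rightarrow> 'k::field) set \<Rightarrow> ('x \<Rightarrow> 'k) set" where
  "lspan S = \<Inter> {W. lsubspace W \<and> S \<subseteq> W}"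

definition ssum :: "('x \<Rightarrow> 'k::field) set \<Rightarrow> ('x \<Rightarrow> 'k) set \<Rightarrow> ('x \<Rightarrow> 'k) set" where
  "ssum U V = {(\<lambda>i. u i + v i) | u v. u \<in> U \<and> v \<in> V}"

definition tens :: "('i \<Rightarrow> 'k::field) set \<Rightarrow> ('i \<Rightarrow> 'k) set \<Rightarrow> ('i \<times> 'i \<Rightarrow> 'k) set" where
  "tens U V = lspan {(\<lambda>(b, c). u b * v c) | u v. u \<in> U \<and> v \<in> V}"

definition subcoalg :: "('i::finite \<Rightarrow> 'i \<Rightarrow> 'i \<Rightarrow> 'k::field) \<Rightarrow> ('i \<Rightarrow> 'k) set \<Rightarrow> bool" where
  "subcoalg D C \<longleftrightarrow> lsubspace C \<and> (\<forall>x\<in>C. hcomul D x \<in> tens C C)"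

definition simple_subcoalg :: "('i::finite \<Rightarrow> 'i \<Rightarrow> 'i \<Rightarrow> 'k::field) \<Rightarrow> ('i \<Rightarrow> 'k) set \<Rightarrow> bool" where
  "simple_subcoalg D C \<longleftrightarrow> subcoalg D C \<and> C \<noteq> {\<lambda>_. 0} \<and>
     (\<forall>C'. subcoalg D C' \<and> C' \<subseteq> C \<longrightarrow> C' = {\<lambda>_. 0} \<or> C' = C)"

definition coradical :: "('i::finite \<Rightarrow> 'i \<Rightarrow> 'i \<Rightarrow> 'k::field) \<Rightarrow> ('i \<Rightarrow> 'k) set" where
  "coradical D = lspan (\<Union> {C. simple_subcoalg D C})"

primrec corad :: "('i::finite \<Rightarrow> 'i \<Rightarrow> 'i \<Rightarrow> 'k::field) \<Rightarrow> nat \<Rightarrow> ('i \<Rightarrow> 'k) set" where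
  "corad D 0 = coradical D"
| "corad D (Suc n) = {x. hcomul D x \<in> ssum (tens UNIV (corad D n)) (tens (coradical D) UNIV)}"

definition connected :: "('i::finite \<Rightarrow> 'i \<Rightarrow> 'i \<Rightarrow> 'k::field) \<Rightarrow> bool" where
  "connected D \<longleftrightarrow> (\<exists>v. v \<noteq> (\<lambda>_. 0) \<and> corad D 0 = lspan {v})"

definition gen_subalg :: "('i::finite \<Rightarrow> 'i \<Rightarrow> 'i \<Rightarrow> 'k::field) \<Rightarrow> ('i \<Rightarrow> 'k) \<Rightarrow> ('i \<Rightarrow> 'k) set \<Rightarrow> ('i \<Rightarrow> 'k) set" where
  "gen_subalg M U S = \<Inter> {B. lsubspace B \<and> U \<in> B \<and> S \<subseteq> B \<and> (\<forall>x\<in>B. \<forall>y\<in>B. hmul M x y \<in> B)}"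

definition upper_ps :: "('i::finite \<Rightarrow> 'i \<Rightarrow> 'i \<Rightarrow> 'k::field) \<Rightarrow> ('i \<Rightarrow> 'k) \<Rightarrow>
   ('i \<Rightarrow> 'i \<Rightarrow> 'i \<Rightarrow> 'k) \<Rightarrow> nat \<Rightarrow> nat \<Rightarrow> ('i \<Rightarrow> 'k) set" where
  "upper_ps M U D p n = (if n = 0 then lspan {U} else gen_subalg M U (corad D (p ^ (n - 1))))"

definition lower_ps :: "('i::finite \<Rightarrow> 'i \<Rightarrow> 'i \<Rightarrow> 'k::field) \<Rightarrow> ('i \<Rightarrow> 'k) \<Rightarrow> nat \<Rightarrow> nat \<Rightarrow> ('i \<Rightarrow> 'k) set" where
  "lower_ps M U p n = {hpow M U f (p ^ n) | f. True}"

text \<open>(L/K)^* = {f in L^*. f(L K^+) = 0}, for K \<subseteq> L = UNIV, as a subset of the dual space.\<close>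
definition dual_quot :: "('i::finite \<Rightarrow> 'i \<Rightarrow> 'i \<Rightarrow> 'k::field) \<Rightarrow> ('i \<Rightarrow> 'k) \<Rightarrow> ('i \<Rightarrow> 'k) set \<Rightarrow> ('i \<Rightarrow> 'k) set" where
  "dual_quot M E K = {f. \<forall>x \<in> lspan {hmul M l y | l y. y \<in> K \<and> hcounit E y = 0}. pairing x f = 0}"

end

theory Submission
  imports Defs "HOL-Library.Function_Algebras"
begin

text \<open>
  Let A be the commutative algebra dual to H and m its augmentation ideal, which is nilpotent since H is connected.
  Tangent vectors at the counit act on A as derivations that kill the subalgebra of p-th powers. Choose coordinates
  \<open>x_i\<close> forming a basis of m modulo its square, and A-linear combinations \<open>\<delta>_i\<close> of these derivations with
  \<open>\<delta>_i x_i = 1\<close> and \<open>\<delta>_i x_j = 0\<close> otherwise. The operators \<open>\<Sum>b<p. (- x_i) ^ b / b! \<delta>_i ^ b\<close> compose to a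
  retraction of A onto its Frobenius image F that is F-linear and maps the N-th power of m into the power of the
  augmentation ideal of F with exponent N / p rounded up. As F is again a sub-bialgebra, induction on n shows, with
  \<open>I_n\<close> denoting the ideal generated by the \<open>p ^ n\<close>-th powers of elements of m: an ideal and coideal contained in the
  power of m with exponent \<open>p ^ (n - 1) + 1\<close> is contained in \<open>I_n\<close>, and every element of A that is coinvariant for the
  quotient by \<open>I_n\<close> is a \<open>p ^ n\<close>-th power. The first fact, applied to the annihilator of \<open>\<Gamma>^n(H)\<close>, identifies
  \<open>\<Gamma>^n(H)\<close> with the annihilator of \<open>I_n\<close>; the second fact is then the second identity.
\<close>

section \<open>Function spaces and the pairing\<close>

text \<open>By the structure theorem for local commutative Hopf algebras over a perfect field, A is
  a truncated polynomial algebra, and both identities could be read off from monomials. No such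
  presentation is established here: the coordinates may satisfy further relations and the
  derivations need not commute. The retraction replaces the projection to constant coefficients over
  the Frobenius image, and it survives these defects because the coordinates are eliminated one at a
  time in a fixed order. It also moves functionals the other way: a functional on the Frobenius
  image extends to A by composition with the retraction, and this is how coideals and coinvariants
  descend. The exponent \<open>p ^ (n - 1) + 1\<close> arises because the j-th layer of the
  coradical filtration is the annihilator of the power of m with exponent j + 1. It reproduces
  itself under division by p with rounding up. For n at least 1 it is at least 2, so tangent vectors
  vanish on the coideal in question; being a coideal then makes it stable under the derivations,
  hence under the retraction.\<close>

definition scl :: "'k::field \<Rightarrow> ('x \<Rightarrow> 'k) \<Rightarrow> 'x \<Rightarrow> 'k" (infixr "\<cdot>" 75) where
  "c \<cdot> f = (\<lambda>i. c * f i)"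

lemma scl_apply: "(c \<cdot> f) i = c * f i"
  by (simp add: scl_def)

text \<open>As simplification rules these would unfold eta-expanded vectors and hide the vector space operations.\<close>

declare plus_fun_apply [simp del] zero_fun_apply [simp del] one_fun_apply [simp del]
  minus_apply [simp del] uminus_apply [simp del]

definition unitv :: "'x \<Rightarrow> 'x \<Rightarrow> 'k::field" where
  "unitv a = (\<lambda>b. kron a b)"

lemma unitv_apply: "unitv a b = (if a = b then 1 else 0)"
  by (simp add: unitv_def kron_def)

lemma sum_fun_apply: "(\<Sum>a\<in>S. f a) i = (\<Sum>a\<in>S. f a i)"
  for f :: "'a \<Rightarrow> 'x \<Rightarrow> 'k::comm_monoid_add"
  by (induction S rule: infinite_finite_induct) (auto simp: plus_fun_apply zero_fun_apply)

lemmas fun_apply = scl_apply sum_fun_apply plus_fun_apply zero_fun_apply minus_apply uminus_apply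

lemma sum_kron [simp]:
  fixes f :: "'x::finite \<Rightarrow> 'k::semiring_1"
  shows "(\<Sum>a\<in>UNIV. f a * (if a = b then 1 else 0)) = f b"
    and "(\<Sum>a\<in>UNIV. f a * (if b = a then 1 else 0)) = f b"
    and "(\<Sum>a\<in>UNIV. (if a = b then 1 else 0) * f a) = f b"
    and "(\<Sum>a\<in>UNIV. (if b = a then 1 else 0) * f a) = f b"
  by (simp_all add: if_distrib if_distribR cong: if_cong)

lemma unitv_expand: "f = (\<Sum>a\<in>UNIV. f a \<cdot> unitv a)" for f :: "'x::finite \<Rightarrow> 'k::field"
  by (rule ext) (simp add: unitv_apply fun_apply)

global_interpretation fv: vector_space "scl :: 'k::field \<Rightarrow> ('x \<Rightarrow> 'k) \<Rightarrow> _"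
  by standard (auto simp: fun_eq_iff algebra_simps fun_apply)

lemma lsubspace_iff: "lsubspace V \<longleftrightarrow> fv.subspace V"
  by (simp add: lsubspace_def fv.subspace_def scl_def zero_fun_def plus_fun_def)

lemma lspan_eq: "lspan S = fv.span S"
  by (simp add: lspan_def fv.span_def hull_def lsubspace_iff)

lemma independent_unitv: "fv.independent (range (unitv :: 'x::finite \<Rightarrow> 'x \<Rightarrow> 'k::field))"
proof (rule fv.independent_if_scalars_zero)
  fix f :: "('x \<Rightarrow> 'k) \<Rightarrow> 'k" and v :: "'x \<Rightarrow> 'k"
  assume s: "(\<Sum>x\<in>range unitv. f x \<cdot> x) = 0" and "v \<in> range unitv"
  then obtain a where v: "v = unitv a" by auto
  have inj: "inj (unitv :: 'x \<Rightarrow> 'x \<Rightarrow> 'k)"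
    by (auto simp: inj_def unitv_apply fun_eq_iff)
  have "(\<Sum>b\<in>UNIV. f (unitv b) \<cdot> unitv b) = 0"
    using s by (simp add: sum.reindex[OF inj])
  then have "(\<Sum>b\<in>UNIV. f (unitv b) \<cdot> unitv b) a = 0" by (simp add: fun_apply)
  then show "f v = 0" by (simp add: unitv_apply v fun_apply)
qed auto

lemma span_unitv: "fv.span (range (unitv :: 'x::finite \<Rightarrow> 'x \<Rightarrow> 'k::field)) = UNIV"
proof -
  have "f \<in> fv.span (range unitv)" for f :: "'x \<Rightarrow> 'k"
    by (subst unitv_expand) (intro fv.span_sum fv.span_scale fv.span_base rangeI)
  then show ?thesis by auto
qed

global_interpretation ffv: finite_dimensional_vector_space
    "scl :: 'k::field \<Rightarrow> ('x::finite \<Rightarrow> 'k) \<Rightarrow> _" "range unitv"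
  by standard (simp_all add: independent_unitv span_unitv)

lemma pairing_simps [simp]:
  fixes f g h :: "'x::finite \<Rightarrow> 'k::field"
  shows "pairing (f + g) h = pairing f h + pairing g h"
    and "pairing f (g + h) = pairing f g + pairing f h"
    and "pairing (f - g) h = pairing f h - pairing g h"
    and "pairing f (g - h) = pairing f g - pairing f h"
    and "pairing (- f) h = - pairing f h" and "pairing f (- h) = - pairing f h"
    and "pairing 0 h = 0" and "pairing f 0 = 0"
    and "pairing (c \<cdot> f) h = c * pairing f h" and "pairing f (c \<cdot> h) = c * pairing f h"
    and "pairing f (unitv a) = f a" and "pairing (unitv a) f = f a"
  by (simp_all add: pairing_def sum.distrib algebra_simps sum_subtractf sum_distrib_left
      unitv_apply sum_negf fun_apply)

lemma pairing_sum:
  "pairing (\<Sum>a\<in>S. f a) h = (\<Sum>a\<in>S. pairing (f a) h)"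
  "pairing h (\<Sum>a\<in>S. f a) = (\<Sum>a\<in>S. pairing h (f a))"
  by (induction S rule: infinite_finite_induct) auto

lemma pairing_commute: "pairing f h = pairing h f"
  by (simp add: pairing_def mult.commute)

text \<open>The identification with the double dual: a functional becomes the vector of its values
  on unit vectors, so functionals on the dual algebra can be handled as elements of H.\<close>

lemma functional_eq_pairing:
  fixes g :: "('x::finite \<Rightarrow> 'k::field) \<Rightarrow> 'k"
  assumes "Vector_Spaces.linear scl (*) g"
  shows "pairing f (\<lambda>a. g (unitv a)) = g f"
proof -
  interpret Vector_Spaces.linear scl "(*)" g by fact
  have "g f = g (\<Sum>a\<in>UNIV. f a \<cdot> unitv a)" using unitv_expand[of f] by simp
  also have "\<dots> = pairing f (\<lambda>a. g (unitv a))"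
    by (simp add: sum scale pairing_def)
  finally show ?thesis ..
qed

lemma pairing_independent_extend:
  fixes B :: "('x::finite \<Rightarrow> 'k::field) set"
  assumes "fv.independent B"
  shows "\<exists>h. \<forall>b\<in>B. pairing b h = \<phi> b"
proof -
  interpret vector_space_pair "scl :: 'k \<Rightarrow> ('x \<Rightarrow> 'k) \<Rightarrow> _" "(*) :: 'k \<Rightarrow> 'k \<Rightarrow> 'k"
    by standard (auto simp: algebra_simps)
  obtain g where "Vector_Spaces.linear scl (*) g" "\<forall>b\<in>B. g b = \<phi> b"
    using linear_independent_extend[OF assms] by blast
  then show ?thesis using functional_eq_pairing by metis
qed

lemma pairing_span_zero:
  assumes "w \<in> fv.span S" "\<And>b. b \<in> S \<Longrightarrow> pairing b h = 0"
  shows "pairing w h = 0"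
proof -
  have "fv.span S \<subseteq> {w. pairing w h = 0}"
    by (rule fv.span_minimal) (auto simp: fv.subspace_def assms)
  with assms show ?thesis by auto
qed

lemma pairing_separates:
  fixes W :: "('x::finite \<Rightarrow> 'k::field) set"
  assumes W: "fv.subspace W" and x: "x \<notin> W"
  shows "\<exists>h. (\<forall>w\<in>W. pairing w h = 0) \<and> pairing x h \<noteq> 0"
proof -
  obtain B where B: "B \<subseteq> W" "fv.independent B" "W \<subseteq> fv.span B"
    using fv.maximal_independent_subset[of W] by blast
  then have sB: "fv.span B = W"
    using W by (simp add: fv.span_minimal subset_antisym)
  then have "fv.independent (insert x B)"
    using x B by (subst fv.independent_insert) auto
  then obtain h where h: "\<forall>b\<in>insert x B. pairing b h = (if b = x then 1 else 0)"
    using pairing_independent_extend[of "insert x B" "\<lambda>b. if b = x then 1 else 0"] by blast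
  have 0: "pairing b h = 0" if "b \<in> B" for b
    using h that B x by auto
  with h sB show ?thesis using pairing_span_zero by fastforce
qed

text \<open>H and its dual have the same carrier, so one operator serves for annihilators in both
  directions.\<close>

definition perp :: "('x::finite \<Rightarrow> 'k::field) set \<Rightarrow> ('x \<Rightarrow> 'k) set" where
  "perp W = {h. \<forall>w\<in>W. pairing w h = 0}"

lemma perp_subspace: "fv.subspace (perp W)"
  by (auto simp: perp_def fv.subspace_def)

lemma perp_antimono: "V \<subseteq> W \<Longrightarrow> perp W \<subseteq> perp V"
  by (auto simp: perp_def)

lemma perp_perp:
  assumes "fv.subspace W" shows "perp (perp W) = W"
proof
  show "perp (perp W) \<subseteq> W"
    using pairing_separates[OF assms] by (fastforce simp: perp_def pairing_commute)
qed (auto simp: perp_def pairing_commute)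

lemma perp_span: "perp (fv.span S) = perp S"
  by (auto simp: perp_def intro: pairing_span_zero fv.span_base)

section \<open>Algebras given by structure constants\<close>

lemma hmul_add: "hmul m (x + y) z = hmul m x z + hmul m y z" "hmul m x (y + z) = hmul m x y + hmul m x z"
  by (auto simp: hmul_def fun_eq_iff fun_apply sum.distrib algebra_simps)

lemma hmul_scl: "hmul m (c \<cdot> x) y = c \<cdot> hmul m x y" "hmul m x (c \<cdot> y) = c \<cdot> hmul m x y"
  by (auto simp: hmul_def fun_eq_iff fun_apply sum_distrib_left algebra_simps)

lemma hmul_zero [simp]: "hmul m 0 y = 0" "hmul m x 0 = 0"
  by (auto simp: hmul_def fun_eq_iff fun_apply)

lemma hmul_diff: "hmul m (x - y) z = hmul m x z - hmul m y z" "hmul m x (y - z) = hmul m x y - hmul m x z"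
  by (auto simp: hmul_def fun_eq_iff fun_apply sum_subtractf algebra_simps)

lemma hmul_sum: "hmul m (\<Sum>a\<in>S. f a) y = (\<Sum>a\<in>S. hmul m (f a) y)"
  "hmul m y (\<Sum>a\<in>S. f a) = (\<Sum>a\<in>S. hmul m y (f a))"
  by (induction S rule: infinite_finite_induct) (auto simp: hmul_add)

lemma hmul_unitv: "hmul m (unitv a) (unitv b) = m a b"
proof
  fix c
  have "hmul m (unitv a) (unitv b) c = (\<Sum>i\<in>UNIV. \<Sum>j\<in>UNIV. if j = b then (if i = a then m a b c else 0) else 0)"
    unfolding hmul_def by (intro sum.cong refl) (auto simp: unitv_apply)
  also have "\<dots> = m a b c" by simp
  finally show "hmul m (unitv a) (unitv b) c = m a b c" .
qed

lemma hmul_expand: "hmul m x y = (\<Sum>a\<in>UNIV. \<Sum>b\<in>UNIV. (x a * y b) \<cdot> m a b)"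
  by (simp add: hmul_def fun_eq_iff fun_apply)

lemma hmul_assocI:
  assumes "\<And>a b c d. (\<Sum>e\<in>UNIV. m a b e * m e c d) = (\<Sum>e\<in>UNIV. m b c e * m a e d)"
  shows "hmul m (hmul m x y) z = hmul m x (hmul m y z)"
proof -
  have *: "hmul m (m a b) (unitv c) = hmul m (unitv a) (m b c)" for a b c
  proof
    fix d
    have "hmul m (m a b) (unitv c) d = (\<Sum>e\<in>UNIV. m a b e * m e c d)"
      by (simp add: hmul_def unitv_apply if_distrib if_distribR cong: if_cong)
    also have "\<dots> = (\<Sum>e\<in>UNIV. m b c e * m a e d)" by (rule assms)
    also have "\<dots> = (\<Sum>i\<in>UNIV. \<Sum>e\<in>UNIV. if i = a then m b c e * m a e d else 0)"
      by (subst sum.swap) simp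
    also have "\<dots> = hmul m (unitv a) (m b c) d"
      unfolding hmul_def by (intro sum.cong refl) (auto simp: unitv_apply)
    finally show "hmul m (m a b) (unitv c) d = hmul m (unitv a) (m b c) d" .
  qed
  have "hmul m (hmul m x y) z = hmul m (hmul m (\<Sum>a\<in>UNIV. x a \<cdot> unitv a) (\<Sum>a\<in>UNIV. y a \<cdot> unitv a)) (\<Sum>a\<in>UNIV. z a \<cdot> unitv a)"
    using unitv_expand[of x] unitv_expand[of y] unitv_expand[of z] by simp
  also have "\<dots> = hmul m (\<Sum>a\<in>UNIV. x a \<cdot> unitv a) (hmul m (\<Sum>a\<in>UNIV. y a \<cdot> unitv a) (\<Sum>a\<in>UNIV. z a \<cdot> unitv a))"
    by (simp add: hmul_sum hmul_scl hmul_unitv * fv.scale_sum_right mult.assoc mult.commute mult.left_commute)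
  also have "\<dots> = hmul m x (hmul m y z)"
    using unitv_expand[of x] unitv_expand[of y] unitv_expand[of z] by simp
  finally show ?thesis .
qed

lemma hmul_unitI:
  assumes "\<And>b c. (\<Sum>a\<in>UNIV. u a * m a b c) = kron b c"
  shows "hmul m u x = x"
proof
  fix c
  have "hmul m u x c = (\<Sum>b\<in>UNIV. x b * (\<Sum>a\<in>UNIV. u a * m a b c))"
    unfolding hmul_def by (subst sum.swap) (simp add: sum_distrib_left algebra_simps)
  then show "hmul m u x c = x c" by (simp add: assms kron_def cong: if_cong)
qed

lemma hmul_commI:
  assumes "\<And>a b c. m a b c = m b a c"
  shows "hmul m x y = hmul m y x"
  unfolding hmul_def by (subst sum.swap) (auto simp: fun_eq_iff assms[of _ _ ] algebra_simps intro!: sum.cong)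

locale sc_calg =
  fixes m :: "'x::finite \<Rightarrow> 'x \<Rightarrow> 'x \<Rightarrow> 'k::field" and u :: "'x \<Rightarrow> 'k"
  assumes sc_assoc: "\<And>a b c d. (\<Sum>e\<in>UNIV. m a b e * m e c d) = (\<Sum>e\<in>UNIV. m b c e * m a e d)"
    and sc_unit: "\<And>b c. (\<Sum>a\<in>UNIV. u a * m a b c) = kron b c"
    and sc_comm: "\<And>a b c. m a b c = m b a c"
    and prime_char: "prime CHAR('k)"
begin

abbreviation mul (infixl "\<odot>" 70) where "x \<odot> y \<equiv> hmul m x y"
abbreviation pw (infixr "\<up>" 80) where "x \<up> n \<equiv> hpow m u x n"

lemma mul_assoc: "x \<odot> y \<odot> z = x \<odot> (y \<odot> z)"
  by (rule hmul_assocI[OF sc_assoc])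

lemma mul_comm: "x \<odot> y = y \<odot> x"
  by (rule hmul_commI[OF sc_comm])

lemma mul_left_comm: "x \<odot> (y \<odot> z) = y \<odot> (x \<odot> z)"
  using mul_assoc mul_comm by metis

lemmas mul_ac = mul_assoc mul_comm mul_left_comm

lemma mul_unit [simp]: "u \<odot> x = x" "x \<odot> u = x"
  using hmul_unitI[of u m, OF sc_unit] mul_comm by metis+

lemma pw_add: "x \<up> (i + j) = x \<up> i \<odot> x \<up> j"
  by (induction j) (auto simp: mul_ac)

lemma pw_mul: "x \<up> (i * j) = (x \<up> i) \<up> j"
  by (induction j) (auto simp: pw_add mul_ac)

lemma pw_mul_distrib: "(x \<odot> y) \<up> n = x \<up> n \<odot> y \<up> n"
  by (induction n) (auto simp: mul_ac)

lemma pw_unit [simp]: "u \<up> n = u"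
  by (induction n) auto

lemma pw_scl: "(c \<cdot> x) \<up> n = (c ^ n) \<cdot> x \<up> n"
  by (induction n) (auto simp: hmul_scl)

lemma binomial: "(x + y) \<up> n = (\<Sum>k\<le>n. of_nat (n choose k) \<cdot> (x \<up> k \<odot> y \<up> (n - k)))"
proof (induction n)
  case (Suc n)
  let ?t = "\<lambda>k. x \<up> k \<odot> y \<up> (Suc n - k)"
  have x: "(x + y) \<up> n \<odot> x = (\<Sum>k\<le>n. of_nat (n choose k) \<cdot> ?t (Suc k))"
    unfolding Suc hmul_sum by (intro sum.cong refl) (auto simp: hmul_scl mul_ac)
  also have "\<dots> = (\<Sum>k=1..Suc n. of_nat (n choose (k - 1)) \<cdot> ?t k)"
    by (rule sum.reindex_bij_witness[of _ "\<lambda>k. k - 1" Suc]) auto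
  also have "\<dots> = (\<Sum>k\<le>Suc n. (if k = 0 then 0 else of_nat (n choose (k - 1))) \<cdot> ?t k)"
    by (rule sum.mono_neutral_cong_left) auto
  finally have x: "(x + y) \<up> n \<odot> x = (\<Sum>k\<le>Suc n. (if k = 0 then 0 else of_nat (n choose (k - 1))) \<cdot> ?t k)" .
  have "(x + y) \<up> n \<odot> y = (\<Sum>k\<le>n. of_nat (n choose k) \<cdot> ?t k)"
    unfolding Suc hmul_sum
    by (intro sum.cong refl) (auto simp: hmul_scl mul_ac Suc_diff_le)
  also have "\<dots> = (\<Sum>k\<le>Suc n. of_nat (n choose k) \<cdot> ?t k)" by (simp add: binomial_eq_0)
  finally have y: "(x + y) \<up> n \<odot> y = (\<Sum>k\<le>Suc n. of_nat (n choose k) \<cdot> ?t k)" .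
  have "(x + y) \<up> Suc n = (x + y) \<up> n \<odot> x + (x + y) \<up> n \<odot> y"
    by (simp add: hmul_add)
  also have "\<dots> = (\<Sum>k\<le>Suc n. of_nat (Suc n choose k) \<cdot> ?t k)"
    unfolding x y sum.distrib[symmetric]
  proof (intro sum.cong refl)
    fix k show "(if k = 0 then 0 else of_nat (n choose (k - 1))) \<cdot> ?t k + of_nat (n choose k) \<cdot> ?t k =
        of_nat (Suc n choose k) \<cdot> ?t k"
      by (cases k) (auto simp: fv.scale_left_distrib)
  qed
  finally show ?case .
qed simp

text \<open>The binomial coefficients strictly between the ends are divisible by the
  characteristic.\<close>

lemma frob_add: "(x + y) \<up> CHAR('k) = x \<up> CHAR('k) + y \<up> CHAR('k)"
proof -
  let ?p = "CHAR('k)"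
  have p: "prime ?p" "?p > 0" using prime_char prime_gt_0_nat by auto
  have 0: "(of_nat (?p choose k) :: 'k) = 0" if "k \<noteq> 0" "k \<noteq> ?p" "k \<le> ?p" for k
    using that p by (subst of_nat_eq_0_iff_char_dvd) (auto intro!: dvd_choose_prime)
  have "(\<Sum>k\<le>?p. of_nat (?p choose k) \<cdot> (x \<up> k \<odot> y \<up> (?p - k))) =
     (\<Sum>k\<in>{0, ?p}. of_nat (?p choose k) \<cdot> (x \<up> k \<odot> y \<up> (?p - k)))"
    by (rule sum.mono_neutral_right) (auto simp: 0)
  also have "\<dots> = x \<up> ?p + y \<up> ?p" using p by (auto simp: add.commute)
  finally show ?thesis by (simp only: binomial)
qed

lemma frob_zero: "0 \<up> CHAR('k) = 0"
  using prime_gt_0_nat[OF prime_char] by (cases "CHAR('k)") auto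

lemma frob_sum: "(\<Sum>a\<in>S. f a) \<up> CHAR('k) = (\<Sum>a\<in>S. f a \<up> CHAR('k))"
  by (induction S rule: infinite_finite_induct) (auto simp: frob_zero frob_add)

end

section \<open>Pure tensors and the tensor square of a commutative algebra\<close>

definition t2 :: "('x \<Rightarrow> 'k::field) \<Rightarrow> ('x \<Rightarrow> 'k) \<Rightarrow> 'x \<times> 'x \<Rightarrow> 'k" where
  "t2 x y = (\<lambda>(b, c). x b * y c)"

lemma t2_apply: "t2 x y (b, c) = x b * y c"
  by (simp add: t2_def)

text \<open>The structure constants of the tensor square; elements of the tensor square are functions on pairs.\<close>

definition msq :: "('x::finite \<Rightarrow> 'x \<Rightarrow> 'x \<Rightarrow> 'k::field) \<Rightarrow> 'x \<times> 'x \<Rightarrow> 'x \<times> 'x \<Rightarrow> 'x \<times> 'x \<Rightarrow> 'k" where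
  "msq m a b c = m (fst a) (fst b) (fst c) * m (snd a) (snd b) (snd c)"

lemma sum_UNIV_pair: "(\<Sum>a\<in>UNIV. f a) = (\<Sum>b\<in>UNIV. \<Sum>c\<in>UNIV. f (b, c))"
  for f :: "'a::finite \<times> 'b::finite \<Rightarrow> 'c::comm_monoid_add"
  by (simp add: sum.cartesian_product flip: UNIV_Times_UNIV)

lemma sum_UNIV_prod:
  fixes f :: "'a::finite \<Rightarrow> 'k::comm_semiring_1" and g :: "'b::finite \<Rightarrow> 'k"
  shows "(\<Sum>a\<in>UNIV. f (fst a) * g (snd a)) = (\<Sum>a\<in>UNIV. f a) * (\<Sum>b\<in>UNIV. g b)"
  by (simp add: sum_UNIV_pair sum_product)

lemma hmul_msq_t2: "hmul (msq m) (t2 x y) (t2 x' y') = t2 (hmul m x x') (hmul m y y')"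
proof
  fix c :: "'a \<times> 'a"
  have "hmul (msq m) (t2 x y) (t2 x' y') c =
     (\<Sum>a\<in>UNIV. (\<Sum>b\<in>UNIV. (x (fst a) * x' (fst b) * m (fst a) (fst b) (fst c)) *
        (y (snd a) * y' (snd b) * m (snd a) (snd b) (snd c))))"
    by (simp add: hmul_def msq_def t2_def split_beta mult_ac)
  also have "\<dots> = (\<Sum>a\<in>UNIV. (\<Sum>b\<in>UNIV. x (fst a) * x' b * m (fst a) b (fst c)) *
      (\<Sum>b\<in>UNIV. y (snd a) * y' b * m (snd a) b (snd c)))"
    by (intro sum.cong refl) (rule sum_UNIV_prod)
  also have "\<dots> = hmul m x x' (fst c) * hmul m y y' (snd c)"
    unfolding hmul_def
    by (rule sum_UNIV_prod[where f = "\<lambda>a. \<Sum>b\<in>UNIV. x a * x' b * m a b (fst c)"])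
  finally show "hmul (msq m) (t2 x y) (t2 x' y') c = t2 (hmul m x x') (hmul m y y') c"
    by (simp add: t2_def split_beta)
qed

context sc_calg
begin

text \<open>Commutativity passes to the tensor square, so Frobenius is additive there as well;
  \<open>cop_frob\<close> relies on this.\<close>

lemma sc_calg_msq: "sc_calg (msq m) (t2 u u)"
proof
  show "(\<Sum>e\<in>UNIV. msq m a b e * msq m e c d) = (\<Sum>e\<in>UNIV. msq m b c e * msq m a e d)" for a b c d
  proof -
    have "(\<Sum>e\<in>UNIV. msq m a b e * msq m e c d) =
      (\<Sum>e\<in>UNIV. m (fst a) (fst b) e * m e (fst c) (fst d)) * (\<Sum>e\<in>UNIV. m (snd a) (snd b) e * m e (snd c) (snd d))"
      by (subst sum_UNIV_prod[symmetric]) (simp add: msq_def mult_ac)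
    also have "\<dots> = (\<Sum>e\<in>UNIV. msq m b c e * msq m a e d)"
      unfolding sc_assoc by (subst sum_UNIV_prod[symmetric]) (simp add: msq_def mult_ac)
    finally show ?thesis .
  qed
  show "(\<Sum>a\<in>UNIV. t2 u u a * msq m a b c) = kron b c" for b c
  proof -
    have "(\<Sum>a\<in>UNIV. t2 u u a * msq m a b c) =
      (\<Sum>a\<in>UNIV. u a * m a (fst b) (fst c)) * (\<Sum>a\<in>UNIV. u a * m a (snd b) (snd c))"
      by (subst sum_UNIV_prod[symmetric]) (simp add: msq_def t2_def split_beta mult_ac)
    then show ?thesis unfolding sc_unit by (simp add: kron_def prod_eq_iff)
  qed
  show "msq m a b c = msq m b a c" for a b c
    by (simp add: msq_def sc_comm)
qed (rule prime_char)

lemma pw_t2: "hpow (msq m) (t2 u u) (t2 x y) n = t2 (x \<up> n) (y \<up> n)"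
  by (induction n) (auto simp: hmul_msq_t2)

lemma mul_span:
  assumes "x \<in> fv.span S" "y \<in> fv.span T" "fv.subspace W"
    and "\<And>s t. s \<in> S \<Longrightarrow> t \<in> T \<Longrightarrow> s \<odot> t \<in> W"
  shows "x \<odot> y \<in> W"
proof -
  have 1: "s \<odot> y \<in> W" if "s \<in> S" for s
  proof -
    have "fv.span T \<subseteq> {y. s \<odot> y \<in> W}"
      by (rule fv.span_minimal) (use assms that in \<open>auto simp: fv.subspace_def hmul_add hmul_scl\<close>)
    then show ?thesis using assms by auto
  qed
  have "fv.span S \<subseteq> {x. x \<odot> y \<in> W}"
    by (rule fv.span_minimal) (use assms 1 in \<open>auto simp: fv.subspace_def hmul_add hmul_scl\<close>)
  then show ?thesis using assms by auto
qed

end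

section \<open>The dual bialgebra\<close>

text \<open>The notation \<open>\<odot>\<close>, \<open>\<up>\<close> refers to the dual algebra, \<open>\<star>\<close> to the algebra H itself.\<close>

locale cobialg =
  fixes M D :: "'i::finite \<Rightarrow> 'i \<Rightarrow> 'i \<Rightarrow> 'k::alg_closed_field"
    and U E :: "'i \<Rightarrow> 'k" and p :: nat
  assumes M_unit: "\<And>b c. (\<Sum>a\<in>UNIV. U a * M a b c) = kron b c"
      "\<And>a c. (\<Sum>b\<in>UNIV. U b * M a b c) = kron a c"
    and D_assoc: "\<And>a b c d. (\<Sum>e\<in>UNIV. D a e d * D e b c) = (\<Sum>e\<in>UNIV. D a b e * D e c d)"
    and D_unit: "\<And>a c. (\<Sum>b\<in>UNIV. E b * D a b c) = kron a c"
    and D_M: "\<And>a b d e. (\<Sum>c\<in>UNIV. M a b c * D c d e) =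
        (\<Sum>d1\<in>UNIV. \<Sum>e1\<in>UNIV. \<Sum>d2\<in>UNIV. \<Sum>e2\<in>UNIV.
            D a d1 e1 * D b d2 e2 * M d1 d2 d * M e1 e2 e)"
    and D_U: "\<And>d e. (\<Sum>c\<in>UNIV. U c * D c d e) = U d * U e"
    and M_E: "\<And>a b. (\<Sum>c\<in>UNIV. M a b c * E c) = E a * E b"
    and U_E: "(\<Sum>c\<in>UNIV. U c * E c) = 1"
    and D_comm: "\<And>a b c. D a b c = D a c b"
    and char_p: "CHAR('k) = p"
    and p_pos: "p > 0"
begin

lemma prime_p: "prime p"
  using prime_CHAR_semidom[where 'a = 'k] char_p p_pos by simp

sublocale sc_calg "dual_mult D" E
proof
  show "(\<Sum>e\<in>UNIV. dual_mult D a b e * dual_mult D e c d) = (\<Sum>e\<in>UNIV. dual_mult D b c e * dual_mult D a e d)" for a b c d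
    using D_assoc[of d c a b] D_assoc[of d a b c]
    by (simp add: dual_mult_def mult.commute)
  show "(\<Sum>a\<in>UNIV. E a * dual_mult D a b c) = kron b c" for b c
    by (simp add: dual_mult_def D_unit kron_def)
  show "dual_mult D a b c = dual_mult D b a c" for a b c
    by (simp add: dual_mult_def D_comm)
qed (simp add: char_p prime_p)

abbreviation dmul (infixl "\<odot>" 70) where "x \<odot> y \<equiv> hmul (dual_mult D) x y"
abbreviation dpw (infixr "\<up>" 80) where "x \<up> n \<equiv> hpow (dual_mult D) E x n"
abbreviation hm (infixl "\<star>" 70) where "x \<star> y \<equiv> hmul M x y"

lemma hm_unit [simp]: "U \<star> x = x" "x \<star> U = x"
proof -
  show "U \<star> x = x" by (rule hmul_unitI[OF M_unit(1)])
  have "x \<star> U = hmul (\<lambda>a b. M b a) U x"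
    unfolding hmul_def by (subst sum.swap) (simp add: mult_ac)
  also have "\<dots> = x" by (rule hmul_unitI) (rule M_unit(2))
  finally show "x \<star> U = x" .
qed

section \<open>Counit and coproduct of the dual algebra, and the action of H on it\<close>

definition eps :: "('i \<Rightarrow> 'k) \<Rightarrow> 'k" where "eps f = pairing f U"

lemma eps_simps [simp]:
  "eps (f + g) = eps f + eps g" "eps (f - g) = eps f - eps g" "eps (- f) = - eps f" "eps 0 = 0"
  "eps (c \<cdot> f) = c * eps f" "eps E = 1"
  by (simp_all add: eps_def U_E pairing_def[of E U] mult.commute[of "E _"])

lemma pairing_hmul_dual: "pairing (f \<odot> g) h = (\<Sum>b\<in>UNIV. \<Sum>c\<in>UNIV. f b * g c * (\<Sum>a\<in>UNIV. h a * D a b c))"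
proof -
  have "pairing (f \<odot> g) h = (\<Sum>a\<in>UNIV. \<Sum>b\<in>UNIV. \<Sum>c\<in>UNIV. f b * g c * (h a * D a b c))"
    by (simp add: pairing_def hmul_def dual_mult_def sum_distrib_right sum_distrib_left mult_ac)
  also have "\<dots> = (\<Sum>b\<in>UNIV. \<Sum>a\<in>UNIV. \<Sum>c\<in>UNIV. f b * g c * (h a * D a b c))"
    by (rule sum.swap)
  also have "\<dots> = (\<Sum>b\<in>UNIV. \<Sum>c\<in>UNIV. \<Sum>a\<in>UNIV. f b * g c * (h a * D a b c))"
    by (intro sum.cong refl sum.swap)
  finally show ?thesis by (simp add: sum_distrib_left)
qed

lemma eps_mul [simp]: "eps (f \<odot> g) = eps f * eps g"
  by (simp add: eps_def pairing_hmul_dual D_U) (simp add: pairing_def sum_product mult_ac)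

lemma eps_pw [simp]: "eps (f \<up> n) = eps f ^ n"
  by (induction n) auto

definition cop :: "('i \<Rightarrow> 'k) \<Rightarrow> 'i \<times> 'i \<Rightarrow> 'k" where
  "cop f = (\<lambda>(b, c). pairing f (M b c))"

text \<open>Here \<open>act h\<close> sends f to the sum of \<open>\<langle>f_2, h\<rangle> f_1\<close>; it is adjoint to right multiplication by h.\<close>

definition act :: "('i \<Rightarrow> 'k) \<Rightarrow> ('i \<Rightarrow> 'k) \<Rightarrow> 'i \<Rightarrow> 'k" where
  "act h f = (\<lambda>b. \<Sum>c\<in>UNIV. h c * cop f (b, c))"

lemma pairing_act: "pairing (act h f) l = pairing f (l \<star> h)"
proof -
  have "pairing (act h f) l = (\<Sum>b\<in>UNIV. \<Sum>c\<in>UNIV. pairing f ((l b * h c) \<cdot> M b c))"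
    by (simp add: pairing_def[of _ l] act_def cop_def sum_distrib_right sum_distrib_left mult_ac)
  then show ?thesis by (simp add: hmul_expand pairing_sum)
qed

lemma pairing_ext: "(\<And>l. pairing f l = pairing g l) \<Longrightarrow> f = g"
proof
  fix a assume "\<And>l. pairing f l = pairing g l"
  from this[of "unitv a"] show "f a = g a" by simp
qed

lemma act_simps:
  "act h (f + g) = act h f + act h g" "act h (c \<cdot> f) = c \<cdot> act h f" "act h 0 = 0"
  "act h (f - g) = act h f - act h g"
  by (rule pairing_ext, simp add: pairing_act)+

lemma act_U [simp]: "act U f = f"
  by (rule pairing_ext) (simp add: pairing_act)

lemma eps_act [simp]: "eps (act h f) = pairing f h"
  by (simp add: eps_def pairing_act)

lemma cop_expand: "cop f = (\<Sum>a\<in>UNIV. t2 (act (unitv a) f) (unitv a))"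
proof
  fix x :: "'i \<times> 'i"
  obtain b c where x: "x = (b, c)" by fastforce
  have a: "act (unitv a) f b = cop f (b, a)" for a
    by (simp add: act_def unitv_apply)
  show "cop f x = (\<Sum>a\<in>UNIV. t2 (act (unitv a) f) (unitv a)) x"
    by (simp add: x fun_apply t2_apply a unitv_apply)
qed

text \<open>Any decomposition of the coproduct computes the action. Hence the action of h on f sees
  h only through its values on the second legs.\<close>

lemma act_cop:
  assumes "cop f = (\<Sum>a\<in>S. t2 (x a) (y a))"
  shows "act h f = (\<Sum>a\<in>S. pairing (y a) h \<cdot> x a)"
proof
  fix b
  have "act h f b = (\<Sum>c\<in>UNIV. \<Sum>a\<in>S. h c * (x a b * y a c))"
    by (simp add: act_def assms fun_apply t2_apply sum_distrib_left)
  also have "\<dots> = (\<Sum>a\<in>S. \<Sum>c\<in>UNIV. h c * (x a b * y a c))" by (rule sum.swap)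
  also have "\<dots> = (\<Sum>a\<in>S. pairing (y a) h \<cdot> x a) b"
    by (simp add: fun_apply pairing_def sum_distrib_left sum_distrib_right mult_ac)
  finally show "act h f b = (\<Sum>a\<in>S. pairing (y a) h \<cdot> x a) b" .
qed

lemma cop_one: "cop E = t2 E E"
  using M_E by (auto simp: cop_def t2_def pairing_def fun_eq_iff mult_ac)

lemma cop_mul: "cop (f \<odot> g) = hmul (msq (dual_mult D)) (cop f) (cop g)"
proof
  fix x :: "'i \<times> 'i"
  obtain a b where x: "x = (a, b)" by fastforce
  let ?t = "\<lambda>d e d1 e1 d2 e2. (f d * g e) * (D a d1 e1 * D b d2 e2 * M d1 d2 d * M e1 e2 e)"
  have "cop (f \<odot> g) x = (\<Sum>d\<in>UNIV. \<Sum>e\<in>UNIV. f d * g e * (\<Sum>c\<in>UNIV. M a b c * D c d e))"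
    by (simp add: x cop_def pairing_hmul_dual)
  also have "\<dots> = (\<Sum>d\<in>UNIV. \<Sum>e\<in>UNIV. \<Sum>d1\<in>UNIV. \<Sum>e1\<in>UNIV. \<Sum>d2\<in>UNIV. \<Sum>e2\<in>UNIV. ?t d e d1 e1 d2 e2)"
    by (simp only: D_M sum_distrib_left)
  \<comment> \<open>Grouping the indices as \<open>z = (d, e)\<close> and
    \<open>w = ((d1, d2), (e1, e2))\<close> turns the reordering of six sums into one exchange; the
    components of \<open>w\<close> are then the arguments of \<open>cop f\<close> and
    \<open>cop g\<close>.\<close>
  also have "\<dots> = (\<Sum>z\<in>UNIV. \<Sum>w\<in>UNIV. ?t (fst z) (snd z) (fst (fst w)) (fst (snd w)) (snd (fst w)) (snd (snd w)))"
    (is "_ = ?S")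
    unfolding sum_UNIV_pair fst_conv snd_conv
    by (rule sum.cong[OF refl], rule sum.cong[OF refl], rule sum.cong[OF refl], rule sum.swap)
  also have "?S = (\<Sum>w\<in>UNIV. \<Sum>z\<in>UNIV. ?t (fst z) (snd z) (fst (fst w)) (fst (snd w)) (snd (fst w)) (snd (snd w)))"
    by (rule sum.swap)
  also have "\<dots> = (\<Sum>w\<in>UNIV. cop f (fst w) * cop g (snd w) * msq (dual_mult D) (fst w) (snd w) x)"
    unfolding x cop_def pairing_def msq_def dual_mult_def split_beta fst_conv snd_conv sum_product sum_distrib_right
    by (intro sum.cong refl) (simp add: sum_UNIV_pair sum_distrib_left mult_ac)
  also have "\<dots> = hmul (msq (dual_mult D)) (cop f) (cop g) x"
    by (simp add: hmul_def sum_UNIV_pair)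
  finally show "cop (f \<odot> g) x = hmul (msq (dual_mult D)) (cop f) (cop g) x" .
qed

lemma cop_pw: "cop (f \<up> n) = hpow (msq (dual_mult D)) (t2 E E) (cop f) n"
  by (induction n) (auto simp: cop_one cop_mul)

text \<open>The coproduct commutes with p-th powers, and Frobenius on the commutative tensor square
  is additive and acts on a pure tensor leg by leg.\<close>

lemma cop_frob:
  assumes "cop f = (\<Sum>a\<in>S. t2 (x a) (y a))"
  shows "cop (f \<up> p) = (\<Sum>a\<in>S. t2 (x a \<up> p) (y a \<up> p))"
proof -
  interpret T: sc_calg "msq (dual_mult D)" "t2 E E" by (rule sc_calg_msq)
  show ?thesis by (simp only: cop_pw assms T.frob_sum[unfolded char_p] pw_t2)
qed

section \<open>Sub-bialgebras and their Frobenius images\<close>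

lemma frob_p_add: "(x + y) \<up> p = x \<up> p + y \<up> p"
  using frob_add by (simp add: char_p)

lemma zero_pw: "n > 0 \<Longrightarrow> 0 \<up> n = 0"
  by (cases n) auto

lemma of_nat_p [simp]: "(of_nat p :: 'k) = 0"
  using of_nat_CHAR[where 'a = 'k] by (simp add: char_p)

lemma of_nat_fact_nonzero: "n < p \<Longrightarrow> (of_nat (fact n) :: 'k) \<noteq> 0"
  using prime_p char_p by (auto simp: of_nat_eq_0_iff_char_dvd prime_dvd_fact_iff simp del: of_nat_fact)

definition subalg :: "('i \<Rightarrow> 'k) set \<Rightarrow> bool" where
  "subalg K \<longleftrightarrow> fv.subspace K \<and> E \<in> K \<and> (\<forall>x\<in>K. \<forall>y\<in>K. x \<odot> y \<in> K)"

definition aug :: "('i \<Rightarrow> 'k) set \<Rightarrow> ('i \<Rightarrow> 'k) set" where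
  "aug K = {f \<in> K. eps f = 0}"

primrec aug_pow :: "('i \<Rightarrow> 'k) set \<Rightarrow> nat \<Rightarrow> ('i \<Rightarrow> 'k) set" where
  "aug_pow K 0 = K"
| "aug_pow K (Suc n) = fv.span {f \<odot> g | f g. f \<in> aug K \<and> g \<in> aug_pow K n}"

definition ideal_of :: "('i \<Rightarrow> 'k) set \<Rightarrow> ('i \<Rightarrow> 'k) set \<Rightarrow> bool" where
  "ideal_of K J \<longleftrightarrow> fv.subspace J \<and> J \<subseteq> K \<and> (\<forall>a\<in>K. \<forall>f\<in>J. a \<odot> f \<in> J)"

definition gideal :: "('i \<Rightarrow> 'k) set \<Rightarrow> ('i \<Rightarrow> 'k) set \<Rightarrow> ('i \<Rightarrow> 'k) set" where
  "gideal K S = fv.span {f \<odot> g | f g. f \<in> S \<and> g \<in> K}"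

text \<open>The coproduct is required to be a sum of pure tensors with both legs in K, so that the Frobenius map can be
  applied leg by leg; this is what makes the image of K under Frobenius a sub-bialgebra again.\<close>

definition subbialg :: "('i \<Rightarrow> 'k) set \<Rightarrow> bool" where
  "subbialg K \<longleftrightarrow> subalg K \<and> (\<forall>f\<in>K. \<exists>x y. (\<forall>a. x a \<in> K \<and> y a \<in> K) \<and>
      cop f = (\<Sum>a\<in>(UNIV :: 'i set). t2 (x a) (y a)))"

definition frob_img :: "nat \<Rightarrow> ('i \<Rightarrow> 'k) set \<Rightarrow> ('i \<Rightarrow> 'k) set" where
  "frob_img n K = (\<lambda>f. f \<up> (p ^ n)) ` K"

text \<open>The quotient of K by this ideal is the function algebra of the n-th Frobenius kernel of
  the corresponding group scheme.\<close>

definition frob_ideal :: "nat \<Rightarrow> ('i \<Rightarrow> 'k) set \<Rightarrow> ('i \<Rightarrow> 'k) set" where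
  "frob_ideal n K = gideal K (frob_img n (aug K))"

text \<open>The functionals that restrict to point derivations of K at the counit.\<close>

definition tangent :: "('i \<Rightarrow> 'k) set \<Rightarrow> ('i \<Rightarrow> 'k) set" where
  "tangent K = {d \<in> perp (aug_pow K 2). pairing E d = 0}"

lemma subalgD:
  assumes "subalg K"
  shows "fv.subspace K" "E \<in> K" "\<And>x y. x \<in> K \<Longrightarrow> y \<in> K \<Longrightarrow> x \<odot> y \<in> K"
    "0 \<in> K" "\<And>x y. x \<in> K \<Longrightarrow> y \<in> K \<Longrightarrow> x + y \<in> K" "\<And>x y. x \<in> K \<Longrightarrow> y \<in> K \<Longrightarrow> x - y \<in> K"
    "\<And>c x. x \<in> K \<Longrightarrow> c \<cdot> x \<in> K"
  using assms
  by (auto simp: subalg_def intro: fv.subspace_0 fv.subspace_add fv.subspace_diff fv.subspace_scale)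

lemma subalg_pw: "subalg K \<Longrightarrow> x \<in> K \<Longrightarrow> x \<up> n \<in> K"
  by (induction n) (auto intro: subalgD)

lemma idlD:
  assumes "ideal_of K J"
  shows "fv.subspace J" "J \<subseteq> K" "\<And>a f. a \<in> K \<Longrightarrow> f \<in> J \<Longrightarrow> a \<odot> f \<in> J"
    "\<And>a f. a \<in> K \<Longrightarrow> f \<in> J \<Longrightarrow> f \<odot> a \<in> J"
    "0 \<in> J" "\<And>x y. x \<in> J \<Longrightarrow> y \<in> J \<Longrightarrow> x + y \<in> J" "\<And>x y. x \<in> J \<Longrightarrow> y \<in> J \<Longrightarrow> x - y \<in> J"
    "\<And>c x. x \<in> J \<Longrightarrow> c \<cdot> x \<in> J"
  using assms mul_comm
  by (auto simp: ideal_of_def intro: fv.subspace_0 fv.subspace_add fv.subspace_diff fv.subspace_scale)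

lemma ideal_of_span:
  assumes K: "subalg K" and S: "S \<subseteq> K" and closed: "\<And>a s. a \<in> K \<Longrightarrow> s \<in> S \<Longrightarrow> a \<odot> s \<in> fv.span S"
  shows "ideal_of K (fv.span S)"
  unfolding ideal_of_def
proof (intro conjI ballI)
  show "fv.span S \<subseteq> K" using S subalgD(1)[OF K] by (rule fv.span_minimal)
  fix a f assume "a \<in> K" "f \<in> fv.span S"
  then show "a \<odot> f \<in> fv.span S"
    using mul_span[of a "{a}" f S "fv.span S"] closed by (auto intro: fv.span_base)
qed simp

lemma aug_subspace: "subalg K \<Longrightarrow> fv.subspace (aug K)"
  by (simp add: aug_def fv.subspace_def subalg_def)

lemma aug_sub: "aug K \<subseteq> K" by (auto simp: aug_def)

lemma ideal_of_aug: "subalg K \<Longrightarrow> ideal_of K (aug K)"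
  unfolding ideal_of_def using aug_subspace by (auto simp: aug_def intro: subalgD)

lemma ideal_of_aug_pow: "subalg K \<Longrightarrow> ideal_of K (aug_pow K n)"
proof (induction n)
  case 0 then show ?case by (auto simp: ideal_of_def subalgD)
next
  case (Suc n)
  let ?S = "{f \<odot> g | f g. f \<in> aug K \<and> g \<in> aug_pow K n}"
  show ?case unfolding aug_pow.simps
  proof (rule ideal_of_span[OF Suc.prems])
    show "?S \<subseteq> K"
      using idlD(2)[OF Suc.IH[OF Suc.prems]] subalgD(3)[OF Suc.prems] aug_sub[of K] by auto
    fix a s assume "a \<in> K" "s \<in> ?S"
    then obtain f g where s: "s = f \<odot> g" "f \<in> aug K" "g \<in> aug_pow K n" by auto
    have "a \<odot> s = (a \<odot> f) \<odot> g" by (simp add: s mul_assoc)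
    moreover have "a \<odot> f \<in> aug K" using idlD(3)[OF ideal_of_aug[OF Suc.prems]] s \<open>a \<in> K\<close> by auto
    ultimately show "a \<odot> s \<in> fv.span ?S" using s(3) by (intro fv.span_base) auto
  qed
qed

lemma aug_pow_Suc_sub: "subalg K \<Longrightarrow> aug_pow K (Suc n) \<subseteq> aug_pow K n"
  unfolding aug_pow.simps
  by (rule fv.span_minimal) (use ideal_of_aug_pow[of K n] aug_sub in \<open>auto dest: idlD intro: idlD(3)\<close>)

lemma aug_pow_antimono: "subalg K \<Longrightarrow> i \<le> j \<Longrightarrow> aug_pow K j \<subseteq> aug_pow K i"
  using lift_Suc_antimono_le[of "aug_pow K"] aug_pow_Suc_sub by blast

lemma aug_pow_1: "subalg K \<Longrightarrow> aug_pow K (Suc 0) = aug K"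
proof
  assume K: "subalg K"
  show "aug_pow K (Suc 0) \<subseteq> aug K"
    unfolding aug_pow.simps
    by (rule fv.span_minimal) (use idlD(4)[OF ideal_of_aug[OF K]] aug_subspace[OF K] in auto)
  show "aug K \<subseteq> aug_pow K (Suc 0)"
  proof
    fix f assume "f \<in> aug K"
    moreover have "f = f \<odot> E" by simp
    ultimately have "f \<in> {f \<odot> g | f g. f \<in> aug K \<and> g \<in> K}" using subalgD(2)[OF K] by blast
    then show "f \<in> aug_pow K (Suc 0)" by (simp add: fv.span_base)
  qed
qed

lemma aug_pow_mul:
  assumes K: "subalg K"
  shows "x \<in> aug_pow K i \<Longrightarrow> y \<in> aug_pow K j \<Longrightarrow> x \<odot> y \<in> aug_pow K (i + j)"
proof (induction i arbitrary: x)
  case 0 then show ?case using idlD(3)[OF ideal_of_aug_pow[OF K]] by simp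
next
  case (Suc i)
  have W: "fv.subspace (aug_pow K (Suc i + j))" using idlD(1)[OF ideal_of_aug_pow[OF K]] .
  show ?case
  proof (rule mul_span[OF _ _ W])
    show "x \<in> fv.span {f \<odot> g | f g. f \<in> aug K \<and> g \<in> aug_pow K i}" using Suc.prems by simp
    show "y \<in> fv.span {y}" by (simp add: fv.span_base)
    fix s t assume "s \<in> {f \<odot> g | f g. f \<in> aug K \<and> g \<in> aug_pow K i}" "t \<in> {y}"
    then obtain f g where "s = f \<odot> g" "f \<in> aug K" "g \<in> aug_pow K i" "t = y" by auto
    then show "s \<odot> t \<in> aug_pow K (Suc i + j)"
      using Suc.IH[of g] Suc.prems by (auto simp: mul_assoc intro!: fv.span_base)
  qed
qed

lemma aug_pow_mono: "K \<subseteq> L \<Longrightarrow> aug_pow K n \<subseteq> aug_pow L n"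
  by (induction n) (auto simp: aug_def intro!: fv.span_mono)

lemma pw_in_aug_pow: "subalg K \<Longrightarrow> f \<in> aug K \<Longrightarrow> f \<up> n \<in> aug_pow K n"
  by (induction n) (auto simp: subalgD mul_comm[of _ f] intro!: fv.span_base)

lemma subbialg_UNIV: "subbialg UNIV"
  unfolding subbialg_def using cop_expand by (force simp: subalg_def)

lemma subbialg_subalg: "subbialg K \<Longrightarrow> subalg K"
  by (simp add: subbialg_def)

lemma cop_subbialg:
  assumes "subbialg K" "f \<in> K"
  obtains x y where "\<And>a. x a \<in> K" "\<And>a. y a \<in> K" "cop f = (\<Sum>a\<in>(UNIV :: 'i set). t2 (x a) (y a))"
  using assms unfolding subbialg_def by metis

lemma act_in:
  assumes "subbialg K" "f \<in> K" shows "act h f \<in> K"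
proof -
  obtain x y where xy: "\<And>a. x a \<in> K" "cop f = (\<Sum>a\<in>(UNIV :: 'i set). t2 (x a) (y a))"
    using cop_subbialg[OF assms] by metis
  show ?thesis unfolding act_cop[OF xy(2)]
    using subalgD(1)[OF subbialg_subalg[OF assms(1)]] xy(1) by (auto intro: fv.subspace_sum fv.subspace_scale)
qed

text \<open>On a sub-bialgebra only the restriction of a functional matters. This permits replacing
  a functional on the Frobenius image by its composite with the retraction.\<close>

lemma act_cong:
  assumes "subbialg K" "f \<in> K" "\<And>g. g \<in> K \<Longrightarrow> pairing g h = pairing g h'"
  shows "act h f = act h' f"
proof -
  obtain x y where xy: "\<And>a. y a \<in> K" "cop f = (\<Sum>a\<in>(UNIV :: 'i set). t2 (x a) (y a))"
    using cop_subbialg[OF assms(1,2)] by metis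
  show ?thesis unfolding act_cop[OF xy(2)] using assms(3)[OF xy(1)] by simp
qed

lemma subalg_frob_img: 
  assumes K: "subalg K" shows "subalg (frob_img (Suc 0) K)"
  unfolding subalg_def fv.subspace_def
proof (intro conjI allI ballI)
  have "0 = 0 \<up> p" using p_pos by (simp add: zero_pw)
  then show "0 \<in> frob_img (Suc 0) K" using subalgD(4)[OF K] by (auto simp: frob_img_def)
  have "E = E \<up> p" by simp
  then show "E \<in> frob_img (Suc 0) K" using subalgD(2)[OF K] by (auto simp: frob_img_def simp del: pw_unit)
next
  fix x y assume "x \<in> frob_img (Suc 0) K" "y \<in> frob_img (Suc 0) K"
  then obtain f g where "x = f \<up> p" "y = g \<up> p" "f \<in> K" "g \<in> K" by (auto simp: frob_img_def)
  then show "x + y \<in> frob_img (Suc 0) K" "x \<odot> y \<in> frob_img (Suc 0) K"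
    using subalgD(3,5)[OF K, of f g] by (auto simp: frob_img_def frob_p_add[symmetric] pw_mul_distrib[symmetric])
next
  fix c :: 'k and x assume "x \<in> frob_img (Suc 0) K"
  then obtain f where f: "x = f \<up> p" "f \<in> K" by (auto simp: frob_img_def)
  \<comment> \<open>Frobenius is only semilinear, so closure under scalars needs p-th roots in the
    field.\<close>
  obtain c' :: 'k where "c' ^ p = c" using nth_root_exists[of p c] p_pos by auto
  then have "c \<cdot> x = (c' \<cdot> f) \<up> p" by (simp add: f pw_scl)
  then show "c \<cdot> x \<in> frob_img (Suc 0) K" using subalgD(7)[OF K f(2)] by (auto simp: frob_img_def)
qed

lemma frob_img_sub: "subalg K \<Longrightarrow> frob_img n K \<subseteq> K"
  by (auto simp: frob_img_def subalg_pw)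

lemma subbialg_frob_img:
  assumes K: "subbialg K" shows "subbialg (frob_img (Suc 0) K)"
  unfolding subbialg_def
proof (intro conjI ballI)
  fix g assume "g \<in> frob_img (Suc 0) K"
  then obtain f where f: "f \<in> K" "g = f \<up> p" by (auto simp: frob_img_def)
  from cop_subbialg[OF K f(1)] obtain x y
    where xy: "\<And>a. x a \<in> K" "\<And>a. y a \<in> K" "cop f = (\<Sum>a\<in>(UNIV :: 'i set). t2 (x a) (y a))" by metis
  show "\<exists>x y. (\<forall>a. x a \<in> frob_img (Suc 0) K \<and> y a \<in> frob_img (Suc 0) K) \<and> cop g = (\<Sum>a\<in>(UNIV :: 'i set). t2 (x a) (y a))"
    using cop_frob[OF xy(3)] xy(1,2) f(2)
    by (intro exI[of _ "\<lambda>a. x a \<up> p"] exI[of _ "\<lambda>a. y a \<up> p"]) (auto simp: frob_img_def)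
qed (rule subalg_frob_img[OF subbialg_subalg[OF K]])

lemma aug_frob_img: "aug (frob_img n K) = frob_img n (aug K)"
  using p_pos by (auto simp: aug_def frob_img_def)

lemma frob_img_Suc: "frob_img (Suc n) K = frob_img n (frob_img (Suc 0) K)"
  by (simp add: frob_img_def image_image pw_mul[symmetric])

text \<open>One induction step trades K for its Frobenius image and lowers n by one; the ideal is
  still generated over K.\<close>

lemma frob_ideal_Suc: "frob_ideal (Suc n) K = gideal K (frob_img n (aug (frob_img (Suc 0) K)))"
  by (simp add: frob_ideal_def frob_img_Suc[of n "aug K"] aug_frob_img)

lemma ideal_of_gideal:
  assumes K: "subalg K" and S: "S \<subseteq> K"
  shows "ideal_of K (gideal K S)"
  unfolding gideal_def
proof (rule ideal_of_span[OF K])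
  show "{f \<odot> g |f g. f \<in> S \<and> g \<in> K} \<subseteq> K" using S subalgD(3)[OF K] by auto
  fix a s assume "a \<in> K" "s \<in> {f \<odot> g |f g. f \<in> S \<and> g \<in> K}"
  then obtain f g where s: "s = f \<odot> g" "f \<in> S" "g \<in> K" by auto
  have "a \<odot> s = f \<odot> (a \<odot> g)" by (simp add: s mul_left_comm)
  then show "a \<odot> s \<in> fv.span {f \<odot> g |f g. f \<in> S \<and> g \<in> K}"
    using s(2) subalgD(3)[OF K \<open>a \<in> K\<close> s(3)] by (intro fv.span_base) auto
qed

lemma ideal_of_frob_ideal: "subalg K \<Longrightarrow> ideal_of K (frob_ideal n K)"
  unfolding frob_ideal_def
  by (rule ideal_of_gideal) (auto simp: frob_img_def aug_def subalg_pw)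

lemma frob_ideal_sub:
  assumes K: "subalg K" and J: "ideal_of K J" and f: "\<And>f. f \<in> aug K \<Longrightarrow> f \<up> (p ^ n) \<in> J"
  shows "frob_ideal n K \<subseteq> J"
  unfolding frob_ideal_def gideal_def
  by (rule fv.span_minimal) (auto simp: frob_img_def intro!: idlD(1,4)[OF J] f)

lemma frob_ideal_aug_pow: "subalg K \<Longrightarrow> N \<le> p ^ n \<Longrightarrow> frob_ideal n K \<subseteq> aug_pow K N"
  by (rule frob_ideal_sub[OF _ ideal_of_aug_pow]) (use pw_in_aug_pow aug_pow_antimono in blast)+

text \<open>Since p is at least 2, tangent vectors annihilate these ideals.\<close>

lemma frob_ideal_tangent: "subalg K \<Longrightarrow> frob_ideal (Suc n) K \<subseteq> aug_pow K 2"
proof (rule frob_ideal_aug_pow)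
  have "2 * 1 \<le> p * p ^ n"
    by (rule mult_le_mono) (use prime_ge_2_nat[OF prime_p] p_pos in auto)
  then show "2 \<le> p ^ Suc n" by simp
qed

text \<open>On K a tangent vector satisfies the Leibniz rule at the counit. Evaluating it on the
  second legs of a product of two coproducts turns this into the rule for a derivation of K.\<close>

lemma act_tangent_mul:
  assumes K: "subbialg K" and d: "d \<in> tangent K" and f: "f \<in> K" "g \<in> K"
  shows "act d (f \<odot> g) = act d f \<odot> g + f \<odot> act d g"
proof -
  have sK: "subalg K" using K by (rule subbialg_subalg)
  obtain x y where xy: "\<And>a. x a \<in> K" "\<And>a. y a \<in> K" "cop f = (\<Sum>a\<in>(UNIV :: 'i set). t2 (x a) (y a))"
    using cop_subbialg[OF K f(1)] by metis
  obtain v w where vw: "\<And>a. v a \<in> K" "\<And>a. w a \<in> K" "cop g = (\<Sum>a\<in>(UNIV :: 'i set). t2 (v a) (w a))"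
    using cop_subbialg[OF K f(2)] by metis
  \<comment> \<open>Removing the counit parts puts both factors in the augmentation ideal, so d
    vanishes on their product.\<close>
  have pr: "pairing (f \<odot> g) d = eps g * pairing f d + eps f * pairing g d" if "f \<in> K" "g \<in> K" for f g
  proof -
    have "(f - eps f \<cdot> E) \<in> aug K" "(g - eps g \<cdot> E) \<in> aug K"
      using that sK by (auto simp: aug_def subalgD)
    then have "(f - eps f \<cdot> E) \<odot> (g - eps g \<cdot> E) \<in> aug_pow K (1 + 1)"
      using aug_pow_mul[OF sK, of _ 1 _ 1] aug_pow_1[OF sK] by auto
    then have "pairing ((f - eps f \<cdot> E) \<odot> (g - eps g \<cdot> E)) d = 0"
      using d by (auto simp: tangent_def perp_def numeral_2_eq_2 simp del: aug_pow.simps)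
    then show ?thesis using d by (simp add: hmul_diff hmul_scl tangent_def algebra_simps)
  qed
  have "cop (f \<odot> g) = (\<Sum>a\<in>UNIV. \<Sum>b\<in>UNIV. t2 (x a \<odot> v b) (y a \<odot> w b))"
    by (simp add: cop_mul xy vw hmul_sum hmul_msq_t2) (rule sum.swap)
  also have "\<dots> = (\<Sum>z\<in>UNIV. t2 (x (fst z) \<odot> v (snd z)) (y (fst z) \<odot> w (snd z)))"
    by (simp add: sum_UNIV_pair)
  finally have "act d (f \<odot> g) = (\<Sum>z\<in>UNIV. pairing (y (fst z) \<odot> w (snd z)) d \<cdot> (x (fst z) \<odot> v (snd z)))"
    by (rule act_cop)
  also have "\<dots> = (\<Sum>a\<in>UNIV. \<Sum>b\<in>UNIV. (pairing (y a) d \<cdot> x a) \<odot> (eps (w b) \<cdot> v b)) +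
      (\<Sum>a\<in>UNIV. \<Sum>b\<in>UNIV. (eps (y a) \<cdot> x a) \<odot> (pairing (w b) d \<cdot> v b))"
    unfolding sum_UNIV_pair fst_conv snd_conv pr[OF xy(2) vw(2)]
    by (simp add: sum.distrib[symmetric] hmul_scl fv.scale_left_distrib mult.commute)
  also have "\<dots> = (\<Sum>a\<in>UNIV. pairing (y a) d \<cdot> x a) \<odot> (\<Sum>b\<in>UNIV. eps (w b) \<cdot> v b) +
      (\<Sum>a\<in>UNIV. eps (y a) \<cdot> x a) \<odot> (\<Sum>b\<in>UNIV. pairing (w b) d \<cdot> v b)"
    unfolding hmul_sum by (subst (1 3) sum.swap) (rule refl)
  also have "\<dots> = act d f \<odot> act U g + act U f \<odot> act d g"
    using act_cop[OF xy(3)] act_cop[OF vw(3)] by (simp add: eps_def del: act_U)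
  finally show ?thesis by simp
qed

lemma deriv_pw:
  assumes K: "subalg K" and leib: "\<And>f g. f \<in> K \<Longrightarrow> g \<in> K \<Longrightarrow> \<delta> (f \<odot> g) = \<delta> f \<odot> g + f \<odot> \<delta> g"
    and f: "f \<in> K"
  shows "\<delta> (f \<up> Suc n) = of_nat (Suc n) \<cdot> (f \<up> n \<odot> \<delta> f)"
proof (induction n)
  case (Suc n)
  have "\<delta> (f \<up> Suc (Suc n)) = \<delta> (f \<up> Suc n) \<odot> f + f \<up> Suc n \<odot> \<delta> f"
    unfolding hpow.simps(2)[of _ _ f "Suc n"] by (intro leib subalg_pw K f)
  also have "\<dots> = of_nat (Suc n) \<cdot> (f \<up> Suc n \<odot> \<delta> f) + f \<up> Suc n \<odot> \<delta> f"
    unfolding Suc by (simp add: hmul_scl mul_ac)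
  also have "\<dots> = of_nat (Suc (Suc n)) \<cdot> (f \<up> Suc n \<odot> \<delta> f)"
    by (simp only: of_nat_Suc[of "Suc n"] fv.scale_left_distrib fv.scale_one add.commute)
  finally show ?case .
qed simp

lemma act_tangent_frob:
  assumes K: "subbialg K" and d: "d \<in> tangent K" and c: "c \<in> frob_img (Suc 0) K"
  shows "act d c = 0"
proof -
  obtain f where f: "f \<in> K" "c = f \<up> p" using c by (auto simp: frob_img_def)
  obtain q where q: "p = Suc q" using p_pos by (cases p) auto
  have "act d (f \<up> p) = of_nat p \<cdot> (f \<up> q \<odot> act d f)"
    unfolding q by (rule deriv_pw[OF subbialg_subalg[OF K] act_tangent_mul[OF K d] f(1)])
  then show ?thesis by (simp add: f(2))
qed

end

section \<open>The retraction onto the Frobenius image\<close>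

text \<open>Coordinates with dual partial derivatives, abstracted from the coproduct that produces
  them in \<open>tangent_coord\<close>. By \<open>leib\<close> and \<open>\<delta>_frob\<close> the
  derivations are linear over the Frobenius image. The duality \<open>\<delta>_dual\<close> is
  exact, not merely modulo the augmentation ideal, which makes the computation on monomials
  possible.\<close>

locale coord = cobialg M D U E p
  for M D :: "'i::finite \<Rightarrow> 'i \<Rightarrow> 'i \<Rightarrow> 'k::alg_closed_field" and U E :: "'i \<Rightarrow> 'k" and p +
  fixes K :: "('i \<Rightarrow> 'k) set" and xs :: "('i \<Rightarrow> 'k) list"
    and \<delta> :: "('i \<Rightarrow> 'k) \<Rightarrow> ('i \<Rightarrow> 'k) \<Rightarrow> 'i \<Rightarrow> 'k" and s :: nat
  assumes K: "subalg K" and xs: "set xs \<subseteq> aug K" "distinct xs"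
    and \<delta>_lin: "\<And>x f g. \<delta> x (f + g) = \<delta> x f + \<delta> x g" "\<And>x c f. \<delta> x (c \<cdot> f) = c \<cdot> \<delta> x f"
    and \<delta>_in: "\<And>x f. f \<in> K \<Longrightarrow> \<delta> x f \<in> K"
    and leib: "\<And>x f g. f \<in> K \<Longrightarrow> g \<in> K \<Longrightarrow> \<delta> x (f \<odot> g) = \<delta> x f \<odot> g + f \<odot> \<delta> x g"
    and \<delta>_dual: "\<And>x y. x \<in> set xs \<Longrightarrow> y \<in> set xs \<Longrightarrow> \<delta> x y = (if x = y then E else 0)"
    and \<delta>_frob: "\<And>x c. c \<in> frob_img (Suc 0) K \<Longrightarrow> \<delta> x c = 0"
    and gen: "\<And>f. f \<in> aug K \<Longrightarrow> \<exists>a\<in>fv.span (set xs). f - a \<in> aug_pow K 2"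
    and nilp: "aug_pow K s = {0}"
begin

abbreviation FK where "FK \<equiv> frob_img (Suc 0) K"

lemma FK: "subalg FK" by (rule subalg_frob_img[OF K])

lemma FK_sub: "FK \<subseteq> K" by (rule frob_img_sub[OF K])

lemma \<delta>_0 [simp]: "\<delta> x 0 = 0"
  using \<delta>_lin(2)[of x 0 0] by simp

lemma \<delta>_diff: "\<delta> x (f - g) = \<delta> x f - \<delta> x g"
  using \<delta>_lin(1)[of x "f - g" g] by (simp add: algebra_simps)

lemma \<delta>_E [simp]: "\<delta> x E = 0"
  using \<delta>_frob subalgD(2)[OF FK] by auto

lemma \<delta>_pow_lin: "(\<delta> x ^^ b) (f + g) = (\<delta> x ^^ b) f + (\<delta> x ^^ b) g" "(\<delta> x ^^ b) (c \<cdot> f) = c \<cdot> (\<delta> x ^^ b) f"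
  by (induction b) (simp_all add: \<delta>_lin)

lemma \<delta>_pow_in: "f \<in> K \<Longrightarrow> (\<delta> x ^^ b) f \<in> K"
  by (induction b) (auto intro: \<delta>_in)

lemma \<delta>_pow_0: "(\<delta> x ^^ b) 0 = 0"
  by (induction b) auto

text \<open>The truncation of the Taylor expansion of \<open>f (x - x)\<close> in the direction of x: it extracts the constant coefficient
  of a polynomial in x of degree less than p.\<close>

definition P :: "('i \<Rightarrow> 'k) \<Rightarrow> ('i \<Rightarrow> 'k) \<Rightarrow> 'i \<Rightarrow> 'k" where
  "P x f = (\<Sum>b<p. ((-1) ^ b * inverse (of_nat (fact b))) \<cdot> (x \<up> b \<odot> (\<delta> x ^^ b) f))"

lemma P_lin: "P x (f + g) = P x f + P x g" "P x (c \<cdot> f) = c \<cdot> P x f"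
  by (simp_all add: P_def \<delta>_pow_lin hmul_add hmul_scl fv.scale_right_distrib sum.distrib
      fv.scale_sum_right mult.commute)

lemma P_0 [simp]: "P x 0 = 0"
  using P_lin(2)[of x 0 0] by simp

lemma xsD: "x \<in> set xs \<Longrightarrow> x \<in> K" "x \<in> set xs \<Longrightarrow> eps x = 0"
  using xs by (auto simp: aug_def)

lemma P_split: "P x f = f + (\<Sum>b\<in>{1..<p}. ((-1) ^ b * inverse (of_nat (fact b))) \<cdot> (x \<up> b \<odot> (\<delta> x ^^ b) f))"
proof -
  have "{..<p} = insert 0 {1..<p}" using p_pos by auto
  then show ?thesis by (simp add: P_def)
qed

lemma P_ideal:
  assumes I: "ideal_of K I" and x: "x \<in> set xs" and b: "\<And>b. b > 0 \<Longrightarrow> (\<delta> x ^^ b) f \<in> I"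
  shows "P x f - f \<in> I"
  unfolding P_split
  using idlD(3)[OF I] b subalg_pw[OF K xsD(1)[OF x]]
  by (auto intro!: fv.subspace_sum fv.subspace_scale idlD(1)[OF I])

lemma ideal_of_K: "ideal_of K K"
  using K by (auto simp: ideal_of_def subalg_def)

lemma P_in: "x \<in> set xs \<Longrightarrow> f \<in> K \<Longrightarrow> P x f \<in> K"
  using subalgD(5)[OF K P_ideal[OF ideal_of_K] , of x f f] \<delta>_pow_in by auto

lemma P_const: "\<delta> x c = 0 \<Longrightarrow> P x c = c"
proof -
  assume c: "\<delta> x c = 0"
  have "(\<delta> x ^^ b) c = 0" if "b > 0" for b
  proof -
    obtain b' where "b = Suc b'" using \<open>b > 0\<close> by (cases b) auto
    then show ?thesis by (simp add: funpow_Suc_right \<delta>_pow_0 c del: funpow.simps)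
  qed
  then show ?thesis unfolding P_split by simp
qed

lemma \<delta>_pow_FK: "c \<in> FK \<Longrightarrow> f \<in> K \<Longrightarrow> (\<delta> x ^^ b) (c \<odot> f) = c \<odot> (\<delta> x ^^ b) f"
  using FK_sub by (induction b) (auto simp: leib \<delta>_frob \<delta>_pow_in subsetD)

lemma P_FK: "c \<in> FK \<Longrightarrow> f \<in> K \<Longrightarrow> P x (c \<odot> f) = c \<odot> P x f"
  by (simp add: P_def \<delta>_pow_FK hmul_sum hmul_scl mul_left_comm)

lemma \<delta>_pow_monomial:
  assumes x: "x \<in> set xs" and c: "c \<in> K" "\<delta> x c = 0"
  shows "(\<delta> x ^^ b) (c \<odot> x \<up> a) = of_nat (fact b * (a choose b)) \<cdot> (c \<odot> x \<up> (a - b))"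
proof (induction b)
  case (Suc b)
  have d: "\<delta> x (c \<odot> x \<up> n) = of_nat n \<cdot> (c \<odot> x \<up> (n - 1))" for n
  proof (cases n)
    case (Suc j)
    have "\<delta> x (x \<up> Suc j) = of_nat (Suc j) \<cdot> (x \<up> j \<odot> \<delta> x x)"
      by (rule deriv_pw[where \<delta> = "\<delta> x", OF K leib xsD(1)[OF x]])
    then show ?thesis using x c
      by (simp add: Suc leib \<delta>_dual subalg_pw[OF K xsD(1)[OF x]] hmul_scl subalgD(3)[OF K] xsD(1) del: hpow.simps)
  qed (simp add: c)
  have n: "(a - b) * (a choose b) = Suc b * (a choose Suc b)"
    by (simp only: binomial_absorb_comp binomial_absorption)
  have "fact b * (a choose b) * (a - b) = fact b * ((a - b) * (a choose b))"
    by simp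
  also have "\<dots> = fact (Suc b) * (a choose Suc b)"
    unfolding n by (simp add: algebra_simps)
  finally have n: "fact b * (a choose b) * (a - b) = fact (Suc b) * (a choose Suc b)" .
  have "(\<delta> x ^^ Suc b) (c \<odot> x \<up> a) = (of_nat (fact b * (a choose b)) * of_nat (a - b)) \<cdot> (c \<odot> x \<up> (a - Suc b))"
    by (simp add: Suc \<delta>_lin d)
  then show ?case unfolding n[symmetric] of_nat_mult by simp
qed simp

text \<open>The factorials cancel against those of \<open>\<delta>_pow_monomial\<close>, which
  leaves the alternating sum of the binomial coefficients of a, that is, 1 - 1 raised to the power
  a.\<close>

lemma P_monomial:
  assumes x: "x \<in> set xs" and c: "c \<in> K" "\<delta> x c = 0" and a: "a < p"
  shows "P x (c \<odot> x \<up> a) = (if a = 0 then c else 0)"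
proof -
  have t: "((-1) ^ b * inverse (of_nat (fact b))) \<cdot> (x \<up> b \<odot> (\<delta> x ^^ b) (c \<odot> x \<up> a)) =
      ((-1) ^ b * of_nat (a choose b)) \<cdot> (c \<odot> x \<up> a)" if "b < p" for b
  proof (cases "b \<le> a")
    case True
    then have "x \<up> b \<odot> (c \<odot> x \<up> (a - b)) = c \<odot> x \<up> a"
      by (subst mul_left_comm) (simp flip: pw_add)
    then show ?thesis
      using of_nat_fact_nonzero[OF that] by (simp add: \<delta>_pow_monomial[OF x c] hmul_scl field_simps)
  qed (simp add: \<delta>_pow_monomial[OF x c] not_le binomial_eq_0)
  have "P x (c \<odot> x \<up> a) = (\<Sum>b<p. ((-1) ^ b * of_nat (a choose b)) \<cdot> (c \<odot> x \<up> a))"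
    unfolding P_def by (intro sum.cong refl t) simp
  also have "\<dots> = (\<Sum>b<p. (-1) ^ b * of_nat (a choose b)) \<cdot> (c \<odot> x \<up> a)"
    by (simp add: fv.scale_sum_left)
  \<comment> \<open>Binomial coefficients beyond a vanish, and the truncation at p loses nothing
    because a is less than p.\<close>
  also have "(\<Sum>b<p. (-1) ^ b * (of_nat (a choose b) :: 'k)) = (\<Sum>b\<le>a. (-1) ^ b * of_nat (a choose b))"
    by (rule sum.mono_neutral_right) (simp, use a in force, simp add: not_le binomial_eq_0)
  also have "\<dots> = (if a = 0 then 1 else 0)"
    using choose_alternating_sum[of a, where 'a = 'k] by auto
  finally show ?thesis by simp
qed

section \<open>Weighted expansions in the coordinates over the Frobenius image\<close>

definition cdiv :: "nat \<Rightarrow> nat" where "cdiv N = (N + p - 1) div p"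

text \<open>Polynomials of degree less than p in each of the listed coordinates, with coefficients in the Frobenius image, where
  each coordinate has weight 1 and each generator of the augmentation ideal of the Frobenius image has weight p; the set
  \<open>W ys N\<close> collects the weights at least N.\<close>

primrec W :: "('i \<Rightarrow> 'k) list \<Rightarrow> nat \<Rightarrow> ('i \<Rightarrow> 'k) set" where
  "W [] N = aug_pow FK (cdiv N)"
| "W (x # ys) N = fv.span {c \<odot> x \<up> a | c a. a < p \<and> c \<in> W ys (N - a)}"

lemma W_subspace: "fv.subspace (W ys N)"
  by (cases ys) (use idlD(1)[OF ideal_of_aug_pow[OF FK]] in auto)

lemma W_K: "set ys \<subseteq> set xs \<Longrightarrow> W ys N \<subseteq> K"
proof (induction ys arbitrary: N)
  case Nil
  then show ?case using idlD(2)[OF ideal_of_aug_pow[OF FK]] FK_sub by auto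
next
  case (Cons x ys)
  have "c \<odot> x \<up> a \<in> K" if "c \<in> W ys (N - a)" for c a
  proof -
    have "c \<in> K" using Cons.IH[of "N - a"] Cons.prems that by auto
    then show ?thesis
      by (rule subalgD(3)[OF K _ subalg_pw[OF K xsD(1)]]) (use Cons.prems in auto)
  qed
  then show ?case unfolding W.simps
    by (intro fv.span_minimal subalgD(1)[OF K]) auto
qed

lemma W_Suc: "W ys (Suc N) \<subseteq> W ys N"
proof (induction ys arbitrary: N)
  case Nil
  show ?case unfolding W.simps
    by (rule aug_pow_antimono[OF FK]) (simp add: cdiv_def div_le_mono)
next
  case (Cons x ys)
  have "W ys (Suc N - a) \<subseteq> W ys (N - a)" for a
    using Cons[of "N - a"] by (cases "a \<le> N") (auto simp: Suc_diff_le)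
  then show ?case unfolding W.simps
    by (intro fv.span_mono Collect_mono ex_mono impI) blast
qed

lemma W_antimono: "i \<le> j \<Longrightarrow> W ys j \<subseteq> W ys i"
  using lift_Suc_antimono_le[of "W ys"] W_Suc by blast

text \<open>Adding p to the weight adds exactly one to its rounded-up quotient by p, which accounts
  for one more factor from the augmentation ideal.\<close>

lemma W_frob: "y \<in> aug FK \<Longrightarrow> f \<in> W ys N \<Longrightarrow> y \<odot> f \<in> W ys (N + p)"
proof (induction ys arbitrary: f N)
  case Nil
  have "N + p + p - 1 = (N + p - 1) + p" using p_pos by simp
  then have "cdiv (N + p) = Suc 0 + cdiv N"
    unfolding cdiv_def using p_pos by (simp only: div_add_self2)
  then show ?case using Nil aug_pow_mul[OF FK, of y "Suc 0" f "cdiv N"] by (simp add: aug_pow_1[OF FK] del: aug_pow.simps)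
next
  case (Cons x ys)
  show ?case
  proof (rule mul_span[of y "{y}" f, OF _ _ W_subspace])
    show "f \<in> fv.span {c \<odot> x \<up> a | c a. a < p \<and> c \<in> W ys (N - a)}" using Cons by simp
    fix t u assume "t \<in> {y}" "u \<in> {c \<odot> x \<up> a | c a. a < p \<and> c \<in> W ys (N - a)}"
    then obtain c a where u: "u = c \<odot> x \<up> a" "a < p" "c \<in> W ys (N - a)" "t = y" by auto
    have "y \<odot> c \<in> W ys (N + p - a)"
      \<comment> \<open>Subtraction is truncated, so for a above N the weight reached exceeds the
        one required.\<close>
      by (rule subsetD[OF W_antimono Cons.IH[OF Cons.prems(1) u(3)]]) arith
    moreover have "t \<odot> u = (y \<odot> c) \<odot> x \<up> a" by (simp add: u mul_assoc)
    ultimately show "t \<odot> u \<in> W (x # ys) (N + p)" using u(2) by (auto intro!: fv.span_base)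
  qed (simp add: fv.span_base)
qed

lemma W_var: "set ys \<subseteq> set xs \<Longrightarrow> x \<in> set ys \<Longrightarrow> f \<in> W ys N \<Longrightarrow> x \<odot> f \<in> W ys (Suc N)"
proof (induction ys arbitrary: f N)
  case (Cons z ys)
  show ?case
  proof (rule mul_span[of x "{x}" f, OF _ _ W_subspace])
    show "f \<in> fv.span {c \<odot> z \<up> a | c a. a < p \<and> c \<in> W ys (N - a)}" using Cons by simp
    fix t u assume "t \<in> {x}" "u \<in> {c \<odot> z \<up> a | c a. a < p \<and> c \<in> W ys (N - a)}"
    then obtain c a where u: "u = c \<odot> z \<up> a" "a < p" "c \<in> W ys (N - a)" "t = x" by auto
    have "\<exists>c' a'. t \<odot> u = c' \<odot> z \<up> a' \<and> a' < p \<and> c' \<in> W ys (Suc N - a')"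
    proof (cases "x = z")
      case False
      then have "x \<odot> c \<in> W ys (Suc N - a)"
        using Cons.prems by (intro subsetD[OF W_antimono Cons.IH[OF _ _ u(3)]]) (arith | auto)+
      then show ?thesis using u by (intro exI[of _ "x \<odot> c"] exI[of _ a]) (simp add: mul_assoc)
    next
      case True
      show ?thesis
      proof (cases "Suc a < p")
        case True
        then show ?thesis using u \<open>x = z\<close>
          by (intro exI[of _ c] exI[of _ "Suc a"]) (simp add: mul_ac)
      next
        case False
        then have a: "p = Suc a" using u by simp
        \<comment> \<open>The exponent overflows from p - 1 to p; the factor
          \<open>x \<up> p\<close> moves into the coefficient, where its weight p makes up for the
          exponent that is lost.\<close>
        have "x \<up> p \<in> aug FK" using Cons.prems xs(1) \<open>x = z\<close> unfolding aug_frob_img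
          by (auto simp: frob_img_def)
        then have "x \<up> p \<odot> c \<in> W ys (Suc N)"
          using a by (intro subsetD[OF W_antimono W_frob[OF _ u(3)]]) (arith | assumption)+
        moreover have "t \<odot> u = (x \<up> p \<odot> c) \<odot> z \<up> 0" using u \<open>x = z\<close> a by (simp add: mul_ac)
        ultimately show ?thesis using p_pos by (intro exI[of _ "x \<up> p \<odot> c"] exI[of _ 0]) simp
      qed
    qed
    then show "t \<odot> u \<in> W (z # ys) (Suc N)" by (auto intro!: fv.span_base)
  qed (simp add: fv.span_base)
qed simp

lemma W_one: "E \<in> W ys 0"
proof (induction ys)
  case Nil
  then show ?case using p_pos by (simp add: cdiv_def subalgD(2)[OF FK])
next
  case (Cons x ys)
  then have "\<exists>c a. E = c \<odot> x \<up> a \<and> a < p \<and> c \<in> W ys (0 - a)"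
    using p_pos by (intro exI[of _ E] exI[of _ 0]) simp
  then show ?case unfolding W.simps by (intro fv.span_base CollectI)
qed

lemma \<delta>_W:
  "set ys \<subseteq> set xs \<Longrightarrow> x \<in> set xs \<Longrightarrow> x \<notin> set ys \<Longrightarrow> f \<in> W ys N \<Longrightarrow> \<delta> x f = 0"
proof (induction ys arbitrary: f N)
  case Nil
  then show ?case using \<delta>_frob idlD(2)[OF ideal_of_aug_pow[OF FK]] by auto
next
  case (Cons z ys)
  have z: "z \<in> K" "\<delta> x z = 0" using Cons.prems by (auto simp: xsD \<delta>_dual)
  have "\<delta> x (z \<up> a) = 0" for a
    using deriv_pw[of K "\<delta> x", OF K leib z(1)] z(2) by (cases a) (auto simp del: hpow.simps(2))
  then have "\<delta> x (c \<odot> z \<up> a) = 0" if "c \<in> W ys (N - a)" for c a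
    using Cons.IH[OF _ _ _ that] Cons.prems that W_K[of ys "N - a"]
    by (subst leib) (auto simp: subalg_pw[OF K z(1)])
  then have "fv.span {c \<odot> z \<up> a | c a. a < p \<and> c \<in> W ys (N - a)} \<subseteq> {f. \<delta> x f = 0}"
    by (intro fv.span_minimal) (auto simp: fv.subspace_def \<delta>_lin)
  then show ?case using Cons.prems by auto
qed

text \<open>\<open>P x\<close> keeps the part without x, and there the coefficient alone carries the
  whole weight N.\<close>

lemma P_W:
  assumes "set (x # ys) \<subseteq> set xs" "distinct (x # ys)" "f \<in> W (x # ys) N"
  shows "P x f \<in> W ys N"
proof -
  have "fv.span {c \<odot> x \<up> a | c a. a < p \<and> c \<in> W ys (N - a)} \<subseteq> {f. P x f \<in> W ys N}"
  proof (rule fv.span_minimal)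
    show "fv.subspace {f. P x f \<in> W ys N}"
      using W_subspace[of ys N] by (auto simp: fv.subspace_def P_lin)
    show "{c \<odot> x \<up> a | c a. a < p \<and> c \<in> W ys (N - a)} \<subseteq> {f. P x f \<in> W ys N}"
    proof clarify
      fix c a assume ca: "a < p" "c \<in> W ys (N - a)"
      then have "P x (c \<odot> x \<up> a) = (if a = 0 then c else 0)"
        using assms W_K[of ys "N - a"] by (intro P_monomial \<delta>_W[of ys x c]) auto
      then show "P x (c \<odot> x \<up> a) \<in> W ys N" using ca fv.subspace_0[OF W_subspace] by auto
    qed
  qed
  then show ?thesis using assms by auto
qed

text \<open>\<open>fold\<close> treats the head of the list first, which is the outermost variable
  of \<open>W\<close>; the coefficients of that variable are free of it, so they are constants for
  its derivation.\<close>

lemma fold_P_W: "set ys \<subseteq> set xs \<Longrightarrow> distinct ys \<Longrightarrow> f \<in> W ys N \<Longrightarrow> fold P ys f \<in> aug_pow FK (cdiv N)"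
proof (induction ys arbitrary: f)
  case (Cons x ys)
  then show ?case using P_W[of x ys f N] by simp
qed simp

text \<open>The homogeneous polynomials of degree n in the coordinates.\<close>

primrec Z :: "nat \<Rightarrow> ('i \<Rightarrow> 'k) set" where
  "Z 0 = fv.span {E}"
| "Z (Suc n) = fv.span {x \<odot> z | x z. x \<in> set xs \<and> z \<in> Z n}"

lemma Z_subspace: "fv.subspace (Z n)"
  by (cases n) auto

text \<open>Modulo the next power, each factor from the augmentation ideal may be replaced by a
  linear combination of coordinates.\<close>

lemma aug_pow_Z: "f \<in> aug_pow K n \<Longrightarrow> \<exists>z\<in>Z n. f - z \<in> aug_pow K (Suc n)"
proof (induction n arbitrary: f)
  case 0
  then show ?case
    by (intro bexI[of _ "eps f \<cdot> E"])
      (auto simp: aug_pow_1[OF K] aug_def subalgD[OF K] fv.span_base fv.span_scale simp del: aug_pow.simps(2))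
next
  case (Suc n)
  let ?R = "{f. \<exists>z\<in>Z (Suc n). f - z \<in> aug_pow K (Suc (Suc n))}"
  have sub: "fv.subspace (aug_pow K (Suc (Suc n)))" using idlD(1)[OF ideal_of_aug_pow[OF K]] .
  have "fv.span {f \<odot> g | f g. f \<in> aug K \<and> g \<in> aug_pow K n} \<subseteq> ?R"
  proof (rule fv.span_minimal)
    show "fv.subspace ?R" unfolding fv.subspace_def
    proof (intro conjI allI ballI)
      show "0 \<in> ?R" using fv.subspace_0[OF Z_subspace] fv.subspace_0[OF sub] by (auto intro!: bexI[of _ 0] simp del: aug_pow.simps Z.simps)
    next
      fix f g assume "f \<in> ?R" "g \<in> ?R"
      then obtain z w where "z \<in> Z (Suc n)" "w \<in> Z (Suc n)" "f - z \<in> aug_pow K (Suc (Suc n))" "g - w \<in> aug_pow K (Suc (Suc n))" by blast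
      then show "f + g \<in> ?R"
        using fv.subspace_add[OF Z_subspace, of z "Suc n" w] fv.subspace_add[OF sub, of "f - z" "g - w"]
        by (auto intro!: bexI[of _ "z + w"] simp: algebra_simps simp del: aug_pow.simps Z.simps)
    next
      fix c f assume "f \<in> ?R"
      then obtain z where "z \<in> Z (Suc n)" "f - z \<in> aug_pow K (Suc (Suc n))" by blast
      then show "c \<cdot> f \<in> ?R"
        using fv.subspace_scale[OF Z_subspace, of z "Suc n" c] fv.subspace_scale[OF sub, of "f - z" c]
        by (auto intro!: bexI[of _ "c \<cdot> z"] simp: fv.scale_right_diff_distrib simp del: aug_pow.simps Z.simps)
    qed
    show "{f \<odot> g | f g. f \<in> aug K \<and> g \<in> aug_pow K n} \<subseteq> ?R"
    proof clarify
      fix f g assume f: "f \<in> aug K" and g: "g \<in> aug_pow K n"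
      obtain a where a: "a \<in> fv.span (set xs)" "f - a \<in> aug_pow K 2" using gen[OF f] by blast
      obtain z where z: "z \<in> Z n" "g - z \<in> aug_pow K (Suc n)" using Suc.IH[OF g] by blast
      have a': "a \<in> aug_pow K (Suc 0)" using a(1) fv.span_minimal[OF xs(1) aug_subspace[OF K]] aug_pow_1[OF K] by auto
      have "a \<odot> z \<in> Z (Suc n)"
        by (rule mul_span[OF a(1) fv.span_base[of z "{z}"]]) (use z in \<open>auto intro!: fv.span_base\<close>)
      moreover have "f \<odot> g - a \<odot> z = (f - a) \<odot> g + a \<odot> (g - z)"
        by (simp add: hmul_diff)
      moreover have "(f - a) \<odot> g \<in> aug_pow K (Suc (Suc n))"
        using aug_pow_mul[OF K a(2) g] by (simp add: numeral_2_eq_2 del: aug_pow.simps)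
      moreover have "a \<odot> (g - z) \<in> aug_pow K (Suc (Suc n))"
        using aug_pow_mul[OF K a' z(2)] by (simp del: aug_pow.simps)
      ultimately show "\<exists>z\<in>Z (Suc n). f \<odot> g - z \<in> aug_pow K (Suc (Suc n))"
        using fv.subspace_add[OF sub] by metis
    qed
  qed
  then show ?case using Suc.prems by auto
qed

lemma aug_pow_ge_zero: "s \<le> n \<Longrightarrow> aug_pow K n = {0}"
  using aug_pow_antimono[OF K, of s n] nilp idlD(5)[OF ideal_of_aug_pow[OF K]] by auto

text \<open>Downward induction from the nilpotency exponent: successive approximation by homogeneous
  polynomials stops because high powers vanish. The auxiliary j bounds the distance to s.\<close>

lemma aug_pow_sub_of_Z:
  assumes V: "\<And>n. fv.subspace (V n)" "\<And>n. V (Suc n) \<subseteq> V n" "\<And>n. Z n \<subseteq> V n"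
  shows "aug_pow K n \<subseteq> V n"
proof -
  have "s \<le> n + j \<Longrightarrow> aug_pow K n \<subseteq> V n" for j
  proof (induction j arbitrary: n)
    case 0
    then show ?case using aug_pow_ge_zero fv.subspace_0[OF V(1)] by auto
  next
    case (Suc j)
    show ?case
    proof
      fix f assume "f \<in> aug_pow K n"
      then obtain z where z: "z \<in> Z n" "f - z \<in> aug_pow K (Suc n)" using aug_pow_Z by blast
      then have "f - z \<in> V (Suc n)" using Suc.IH[of "Suc n"] Suc.prems by (auto simp del: aug_pow.simps)
      then have "f - z \<in> V n" "z \<in> V n" using V z(1) by blast+
      then show "f \<in> V n" using fv.subspace_add[OF V(1)] by fastforce
    qed
  qed
  from this[of s] show ?thesis by simp
qed

lemma aug_pow_W: "aug_pow K n \<subseteq> W xs n"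
proof (rule aug_pow_sub_of_Z)
  show "Z n \<subseteq> W xs n" for n
  proof (induction n)
    case 0
    show ?case unfolding Z.simps by (rule fv.span_minimal[OF _ W_subspace]) (simp add: W_one)
  next
    case (Suc n)
    then have "{x \<odot> z | x z. x \<in> set xs \<and> z \<in> Z n} \<subseteq> W xs (Suc n)"
      using W_var[of xs _ _ n] by blast
    then show ?case unfolding Z.simps by (rule fv.span_minimal[OF _ W_subspace])
  qed
qed (rule W_subspace W_Suc)+

definition T :: "('i \<Rightarrow> 'k) \<Rightarrow> 'i \<Rightarrow> 'k" where "T = fold P xs"

lemma T_aug_pow: "f \<in> aug_pow K n \<Longrightarrow> T f \<in> aug_pow FK (cdiv n)"
  unfolding T_def using fold_P_W[of xs f n] aug_pow_W xs by auto

lemma T_in: "f \<in> K \<Longrightarrow> T f \<in> FK"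
  using T_aug_pow[of f 0] idlD(2)[OF ideal_of_aug_pow[OF FK]] by auto

lemma fold_P_lin: "fold P ys (f + g) = fold P ys f + fold P ys g" "fold P ys (c \<cdot> f) = c \<cdot> fold P ys f"
  by (induction ys arbitrary: f g) (auto simp: P_lin)

lemma T_lin: "T (f + g) = T f + T g" "T (c \<cdot> f) = c \<cdot> T f"
  by (simp_all add: T_def fold_P_lin)

lemma T_FK: "c \<in> FK \<Longrightarrow> T c = c"
proof -
  assume c: "c \<in> FK"
  have "fold P ys c = c" for ys
    by (induction ys) (auto simp: P_const[OF \<delta>_frob[OF c]])
  then show ?thesis by (simp add: T_def)
qed

lemma T_FK_mul: "c \<in> FK \<Longrightarrow> f \<in> K \<Longrightarrow> T (c \<odot> f) = c \<odot> T f"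
proof -
  assume c: "c \<in> FK"
  have "set ys \<subseteq> set xs \<Longrightarrow> f \<in> K \<Longrightarrow> fold P ys (c \<odot> f) = c \<odot> fold P ys f" for ys
    by (induction ys arbitrary: f) (auto simp: P_FK[OF c] P_in)
  then show "f \<in> K \<Longrightarrow> ?thesis" by (auto simp: T_def)
qed

section \<open>Ideals stable under the derivations\<close>

definition stable :: "('i \<Rightarrow> 'k) set \<Rightarrow> bool" where
  "stable J \<longleftrightarrow> ideal_of K J \<and> (\<forall>x\<in>set xs. \<forall>f\<in>J. \<delta> x f \<in> J)"

lemma stable_pow: "stable J \<Longrightarrow> x \<in> set xs \<Longrightarrow> f \<in> J \<Longrightarrow> (\<delta> x ^^ b) f \<in> J"
  by (induction b) (auto simp: stable_def)

lemma P_stable: "stable J \<Longrightarrow> x \<in> set xs \<Longrightarrow> f \<in> J \<Longrightarrow> P x f \<in> J"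
  using P_ideal[of J x f] stable_pow[of J x f] idlD(6)[of K J "P x f - f" f] by (auto simp: stable_def)

lemma T_stable: "stable J \<Longrightarrow> f \<in> J \<Longrightarrow> T f \<in> J"
proof -
  assume J: "stable J"
  have "set ys \<subseteq> set xs \<Longrightarrow> f \<in> J \<Longrightarrow> fold P ys f \<in> J" for ys
    by (induction ys arbitrary: f) (auto simp: P_stable[OF J])
  then show "f \<in> J \<Longrightarrow> ?thesis" by (auto simp: T_def)
qed

text \<open>Modulo I, an f whose derivatives all lie in I is a constant, and each \<open>P\<close>
  fixes constants.\<close>

lemma T_cong:
  assumes I: "stable I" and f: "f \<in> K" "\<And>x. x \<in> set xs \<Longrightarrow> \<delta> x f \<in> I"
  shows "f - T f \<in> I"
proof -
  have iI: "ideal_of K I" using I by (simp add: stable_def)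
  have "set ys \<subseteq> set xs \<Longrightarrow> f \<in> K \<Longrightarrow> (\<forall>x\<in>set xs. \<delta> x f \<in> I) \<Longrightarrow> f - fold P ys f \<in> I" for ys
  proof (induction ys arbitrary: f)
    case Nil
    then show ?case using idlD(5)[OF iI] by simp
  next
    case (Cons x ys)
    have "(\<delta> x ^^ b) f \<in> I" if "b > 0" for b
    proof -
      obtain b' where "b = Suc b'" using \<open>b > 0\<close> by (cases b) auto
      then have "(\<delta> x ^^ b) f = (\<delta> x ^^ b') (\<delta> x f)" by (simp add: funpow_Suc_right del: funpow.simps)
      then show ?thesis using stable_pow[OF I, of x "\<delta> x f" b'] Cons.prems by auto
    qed
    then have 1: "P x f - f \<in> I" using P_ideal[OF iI] Cons.prems by auto
    have 2: "P x f \<in> K" using P_in Cons.prems by auto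
    \<comment> \<open>The hypothesis on derivatives persists for \<open>P x f\<close>, which differs
      from f by an element of the stable ideal I.\<close>
    have "\<delta> y (P x f) \<in> I" if "y \<in> set xs" for y
    proof -
      have "\<delta> y (P x f) = \<delta> y f + \<delta> y (P x f - f)" by (simp add: \<delta>_diff)
      then show ?thesis using I 1 that Cons.prems idlD(6)[OF iI] by (auto simp: stable_def)
    qed
    then have "P x f - fold P ys (P x f) \<in> I" using Cons.IH[OF _ 2] Cons.prems by auto
    then show ?case using idlD(7)[OF iI _ 1] by fastforce
  qed
  then show ?thesis using f by (auto simp: T_def)
qed

text \<open>A filtration lowered by every derivation \<open>\<delta> x\<close>.\<close>

primrec Y :: "nat \<Rightarrow> ('i \<Rightarrow> 'k) set" where
  "Y 0 = {0}"
| "Y (Suc n) = fv.span (insert E {x \<odot> z | x z. x \<in> set xs \<and> z \<in> Y n})"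

lemma Y_subspace: "fv.subspace (Y n)"
  by (cases n) auto

lemma Y_Suc: "Y n \<subseteq> Y (Suc n)"
proof (induction n)
  case 0 then show ?case using fv.subspace_0[OF Y_subspace] by (simp del: Y.simps(2))
next
  case (Suc n) then show ?case unfolding Y.simps(2) by (intro fv.span_mono) blast
qed

lemma Y_K: "Y n \<subseteq> K"
proof (induction n)
  case (Suc n)
  then show ?case unfolding Y.simps
    by (intro fv.span_minimal subalgD(1)[OF K]) (auto intro: subalgD(2)[OF K] subalgD(3)[OF K xsD(1)])
qed (simp add: subalgD[OF K])

lemma \<delta>_Y: "x \<in> set xs \<Longrightarrow> f \<in> Y (Suc n) \<Longrightarrow> \<delta> x f \<in> Y n"
proof (induction n arbitrary: f)
  case 0
  have "fv.span (insert E {x \<odot> z | x z. x \<in> set xs \<and> z \<in> Y 0}) \<subseteq> {f. \<delta> x f = 0}"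
    by (rule fv.span_minimal) (auto simp: fv.subspace_def \<delta>_lin)
  then show ?case using 0 by auto
next
  case (Suc n)
  have "fv.span (insert E {x \<odot> z | x z. x \<in> set xs \<and> z \<in> Y (Suc n)}) \<subseteq> {f. \<delta> x f \<in> Y (Suc n)}"
  proof (rule fv.span_minimal)
    show "fv.subspace {f. \<delta> x f \<in> Y (Suc n)}"
      using Y_subspace[of "Suc n"] by (simp add: fv.subspace_def \<delta>_lin del: Y.simps)
    have "\<delta> x (y \<odot> z) \<in> Y (Suc n)" if y: "y \<in> set xs" and z: "z \<in> Y (Suc n)" for y z
    proof -
      have "y \<odot> \<delta> x z \<in> Y (Suc n)" using Suc.IH[OF Suc.prems(1) z] y by (auto intro!: fv.span_base)
      moreover have "\<delta> x y \<odot> z \<in> Y (Suc n)"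
        using z fv.subspace_0[OF Y_subspace] y Suc.prems by (auto simp: \<delta>_dual simp del: Y.simps)
      ultimately show ?thesis
        using leib[OF xsD(1)[OF y], of z x] z Y_K[of "Suc n"] fv.subspace_add[OF Y_subspace]
        by (auto simp del: Y.simps)
    qed
    then show "insert E {x \<odot> z | x z. x \<in> set xs \<and> z \<in> Y (Suc n)} \<subseteq> {f. \<delta> x f \<in> Y (Suc n)}"
      using fv.subspace_0[OF Y_subspace, of "Suc n"] by (auto simp del: Y.simps)
  qed
  then show ?case using Suc.prems by (auto simp only: Y.simps(2)[of "Suc n"])
qed

text \<open>Approximation by homogeneous polynomials terminates by nilpotence, so every element of K
  is a polynomial in the coordinates.\<close>

lemma K_Y: "f \<in> K \<Longrightarrow> \<exists>n. f \<in> Y n"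
proof -
  have Ymono: "i \<le> j \<Longrightarrow> Y i \<subseteq> Y j" for i j
    using lift_Suc_mono_le[of Y] Y_Suc by blast
  have ZY: "Z n \<subseteq> Y (Suc n)" for n
  proof (induction n)
    case 0
    show ?case unfolding Z.simps Y.simps(2) by (rule fv.span_mono) simp
  next
    case (Suc n)
    then show ?case unfolding Z.simps Y.simps(2)[of "Suc n"] by (intro fv.span_mono) blast
  qed
  have "s \<le> n + j \<Longrightarrow> f \<in> aug_pow K n \<Longrightarrow> f \<in> Y (n + j)" for j n f
  proof (induction j arbitrary: n f)
    case 0
    then show ?case using aug_pow_ge_zero[of n] fv.subspace_0[OF Y_subspace] by auto
  next
    case (Suc j)
    obtain z where z: "z \<in> Z n" "f - z \<in> aug_pow K (Suc n)" using aug_pow_Z Suc.prems by blast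
    then have "f - z \<in> Y (n + Suc j)" using Suc.IH[of "Suc n" "f - z"] Suc.prems by (simp del: Y.simps aug_pow.simps)
    moreover have "z \<in> Y (n + Suc j)" using z ZY[of n] Ymono[of "Suc n" "n + Suc j"] by (auto simp del: Y.simps)
    ultimately show ?case using fv.subspace_add[OF Y_subspace] by fastforce
  qed
  from this[of 0 s] show "f \<in> K \<Longrightarrow> ?thesis" by auto
qed

text \<open>Induction on the filtration \<open>Y\<close>: the derivatives of f lie in J and one step
  lower, hence in I, so f agrees with \<open>T f\<close> modulo I by \<open>T_cong\<close>, and
  \<open>T f\<close> lies in I by assumption.\<close>

lemma stable_sub:
  assumes I: "stable I" and J: "stable J" and T: "\<And>f. f \<in> J \<Longrightarrow> T f \<in> I"
  shows "J \<subseteq> I"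
proof -
  have iI: "ideal_of K I" and iJ: "ideal_of K J" using I J by (simp_all add: stable_def)
  have "f \<in> J \<Longrightarrow> f \<in> Y n \<Longrightarrow> f \<in> I" for f n
  proof (induction n arbitrary: f)
    case 0
    then show ?case using idlD(5)[OF iI] by simp
  next
    case (Suc n)
    have "f - T f \<in> I"
      by (rule T_cong[OF I]) (use Suc J \<delta>_Y idlD(2)[OF iJ] in \<open>auto simp: stable_def simp del: Y.simps\<close>)
    then show ?case using idlD(6)[OF iI _ T[OF Suc.prems(1)]] by fastforce
  qed
  then show ?thesis using K_Y idlD(2)[OF iJ] by blast
qed

end

text \<open>Applied to the retraction, this extends functionals from the Frobenius image to
  K.\<close>

lemma adjoint_exists:
  fixes T :: "('x::finite \<Rightarrow> 'k::field) \<Rightarrow> 'x \<Rightarrow> 'k"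
  assumes "\<And>f g. T (f + g) = T f + T g" "\<And>c f. T (c \<cdot> f) = c \<cdot> T f"
  shows "\<exists>d'. \<forall>f. pairing f d' = pairing (T f) d"
proof -
  have "Vector_Spaces.linear scl (*) (\<lambda>f. pairing (T f) d)"
    by unfold_locales (auto simp: assms algebra_simps)
  from functional_eq_pairing[OF this] show ?thesis by blast
qed

context cobialg
begin

section \<open>Coordinates and dual derivations from the cotangent space\<close>

definition cotangent_basis ::
  "('i \<Rightarrow> 'k) set \<Rightarrow> ('i \<Rightarrow> 'k) list \<Rightarrow> (('i \<Rightarrow> 'k) \<Rightarrow> 'i \<Rightarrow> 'k) \<Rightarrow> bool" where
  "cotangent_basis K xs d \<longleftrightarrow> distinct xs \<and> set xs \<subseteq> aug K \<and> (\<forall>x\<in>set xs. d x \<in> tangent K) \<and>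
    (\<forall>x\<in>set xs. \<forall>y\<in>set xs. pairing y (d x) = (if x = y then 1 else 0)) \<and>
    (\<forall>f\<in>aug K. \<exists>a\<in>fv.span (set xs). f - a \<in> aug_pow K 2)"

text \<open>A basis of the square of the augmentation ideal is extended to a basis of that ideal and
  then by \<open>E\<close>. The dual functionals of the vectors added in the first extension kill
  the square and \<open>E\<close>, hence are tangent.\<close>

lemma cotangent_basis_exists:
  assumes K: "subalg K"
  shows "\<exists>xs d. cotangent_basis K xs d"
proof -
  have mp2: "aug_pow K 2 \<subseteq> aug K"
    using aug_pow_antimono[OF K, of "Suc 0" 2] aug_pow_1[OF K] by simp
  obtain B0 where B0: "B0 \<subseteq> aug_pow K 2" "fv.independent B0" "aug_pow K 2 \<subseteq> fv.span B0"
    using fv.maximal_independent_subset by blast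
  obtain B where B: "B0 \<subseteq> B" "B \<subseteq> aug K" "fv.independent B" "aug K \<subseteq> fv.span B"
    using fv.maximal_independent_subset_extend[of B0 "aug K"] B0 mp2 by blast
  have "fv.span B \<subseteq> aug K" using B(2) by (rule fv.span_minimal[OF _ aug_subspace[OF K]])
  then have EB: "E \<notin> fv.span B" by (auto simp: aug_def)
  then have ind: "fv.independent (insert E B)"
    using B(3) by (subst fv.independent_insert) auto
  have "\<exists>h. \<forall>b\<in>insert E B. pairing b h = (if x = b then 1 else 0)" for x
    by (rule pairing_independent_extend[OF ind])
  then obtain d where d: "\<And>x b. b \<in> insert E B \<Longrightarrow> pairing b (d x) = (if x = b then 1 else 0)"
    by metis
  obtain xs where xs: "set xs = B - B0" "distinct xs"
    using finite_distinct_list[of "B - B0"] ffv.finiteI_independent[OF B(3)] by auto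
  have EnB: "E \<notin> B" using EB fv.span_base by blast
  have 1: "d x \<in> tangent K" if x: "x \<in> set xs" for x
  proof -
    have "pairing b (d x) = 0" if "b \<in> B0" for b
      using d[of b x] that B x xs by auto
    then have "d x \<in> perp (fv.span B0)" unfolding perp_span by (simp add: perp_def)
    then show ?thesis
      using B0(3) d[of E x] EnB x xs by (auto simp: tangent_def perp_def)
  qed
  have 2: "\<exists>a\<in>fv.span (set xs). f - a \<in> aug_pow K 2" if "f \<in> aug K" for f
  proof -
    have "B = set xs \<union> B0" using xs B(1) by auto
    with that have "f \<in> fv.span (set xs \<union> B0)" using B(4) by blast
    then obtain a b where ab: "f = a + b" "a \<in> fv.span (set xs)" "b \<in> fv.span B0"
      unfolding fv.span_Un by blast
    have "b \<in> aug_pow K 2"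
      using ab(3) fv.span_minimal[OF B0(1) idlD(1)[OF ideal_of_aug_pow[OF K]]] by blast
    then have "f - a \<in> aug_pow K 2" using ab(1) by simp
    with ab(2) show ?thesis by blast
  qed
  have 3: "set xs \<subseteq> aug K" using xs(1) B(2) by blast
  have 4: "pairing y (d x) = (if x = y then 1 else 0)" if "x \<in> set xs" "y \<in> set xs" for x y
    using d[of y x] that xs(1) by auto
  have "cotangent_basis K xs d" unfolding cotangent_basis_def
    by (intro conjI ballI xs(2) 1 2 3 4)
  then show ?thesis by (intro exI)
qed

text \<open>Nakayama's lemma in matrix form, by Newton iteration for the inverse.\<close>

lemma inverse_matrix_mod_aug_pow:
  fixes X :: "'a set"
  assumes K: "subalg K" and X: "finite X"
    and g: "\<And>z y. z \<in> X \<Longrightarrow> y \<in> X \<Longrightarrow> g z y \<in> K"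
      "\<And>z y. z \<in> X \<Longrightarrow> y \<in> X \<Longrightarrow> g z y - (if z = y then E else 0) \<in> aug K"
  shows "\<exists>c. (\<forall>x z. c x z \<in> K) \<and>
     (\<forall>x\<in>X. \<forall>y\<in>X. (\<Sum>z\<in>X. c x z \<odot> g z y) - (if x = y then E else 0) \<in> aug_pow K (Suc n))"
proof (induction n)
  case 0
  let ?c = "\<lambda>x z. if x = z then E else 0"
  have "(\<Sum>z\<in>X. ?c x z \<odot> g z y) = (\<Sum>z\<in>X. if x = z then g z y else 0)" for x y
    by (intro sum.cong) auto
  then have "(\<Sum>z\<in>X. ?c x z \<odot> g z y) = g x y" if "x \<in> X" for x y
    using X that by simp
  then show ?case using g(2) subalgD(2,4)[OF K]
    by (intro exI[of _ ?c]) (auto simp: aug_pow_1[OF K] simp del: aug_pow.simps)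
next
  case (Suc n)
  then obtain c where c: "\<And>x z. c x z \<in> K"
    "\<And>x y. x \<in> X \<Longrightarrow> y \<in> X \<Longrightarrow> (\<Sum>z\<in>X. c x z \<odot> g z y) - (if x = y then E else 0) \<in> aug_pow K (Suc n)"
    by blast
  define \<kappa> where "\<kappa> = (\<lambda>x y :: 'a. if x = y then E else 0)"
  define e where "e = (\<lambda>x y. (\<Sum>z\<in>X. c x z \<odot> g z y) - \<kappa> x y)"
  have e: "e x y \<in> aug_pow K (Suc n)" if "x \<in> X" "y \<in> X" for x y
    using c(2)[OF that] by (simp add: e_def \<kappa>_def)
  have eK: "e x y \<in> K" if "y \<in> X" for x y
    unfolding e_def \<kappa>_def using c(1) g(1) that
    by (intro subalgD(6)[OF K] fv.subspace_sum subalgD(1)[OF K] subalgD(3)[OF K]) (auto simp: subalgD[OF K])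
  \<comment> \<open>In matrices, c g = 1 + e. The corrected inverse (1 - e) c therefore has error -
    e^2, which lies in a higher power.\<close>
  define c' where "c' = (\<lambda>x z. c x z - (\<Sum>w\<in>X. e x w \<odot> c w z))"
  have c'K: "c' x z \<in> K" for x z
    unfolding c'_def using c(1) eK
    by (intro subalgD(6)[OF K] fv.subspace_sum subalgD(1)[OF K] subalgD(3)[OF K]) auto
  have "(\<Sum>z\<in>X. c' x z \<odot> g z y) - \<kappa> x y \<in> aug_pow K (Suc (Suc n))" if xy: "x \<in> X" "y \<in> X" for x y
  proof -
    have s: "(\<Sum>z\<in>X. c w z \<odot> g z y) = e w y + \<kappa> w y" for w by (simp add: e_def)
    have "(\<Sum>z\<in>X. c' x z \<odot> g z y) = (\<Sum>z\<in>X. c x z \<odot> g z y) - (\<Sum>z\<in>X. \<Sum>w\<in>X. e x w \<odot> (c w z \<odot> g z y))"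
      by (simp add: c'_def hmul_diff hmul_sum sum_subtractf mul_assoc)
    also have "(\<Sum>z\<in>X. \<Sum>w\<in>X. e x w \<odot> (c w z \<odot> g z y)) = (\<Sum>w\<in>X. e x w \<odot> (e w y + \<kappa> w y))"
      by (subst sum.swap) (simp add: hmul_sum[symmetric] s)
    also have "\<dots> = (\<Sum>w\<in>X. e x w \<odot> e w y) + (\<Sum>w\<in>X. if w = y then e x w else 0)"
      by (simp add: hmul_add sum.distrib \<kappa>_def if_distrib[of "hmul _ _"] cong: if_cong)
    also have "(\<Sum>w\<in>X. if w = y then e x w else 0) = e x y" using X xy by simp
    finally have "(\<Sum>z\<in>X. c' x z \<odot> g z y) - \<kappa> x y = - (\<Sum>w\<in>X. e x w \<odot> e w y)"
      unfolding s by simp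
    moreover have "e x w \<odot> e w y \<in> aug_pow K (Suc (Suc n))" if "w \<in> X" for w
      by (rule subsetD[OF aug_pow_antimono[OF K] aug_pow_mul[OF K e[OF xy(1) that] e[OF that xy(2)]]]) simp
    then have "- (\<Sum>w\<in>X. e x w \<odot> e w y) \<in> aug_pow K (Suc (Suc n))"
      by (intro fv.subspace_neg fv.subspace_sum idlD(1)[OF ideal_of_aug_pow[OF K]])
    ultimately show ?thesis by (simp only:)
  qed
  then show ?case using c'K by (intro exI[of _ c']) (auto simp: \<kappa>_def simp del: aug_pow.simps)
qed

text \<open>The coordinate-free counterpart of \<open>stable\<close>, so that later statements do
  not depend on a choice of coordinates.\<close>

definition tstable :: "('i \<Rightarrow> 'k) set \<Rightarrow> ('i \<Rightarrow> 'k) set \<Rightarrow> bool" where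
  "tstable K J \<longleftrightarrow> ideal_of K J \<and> (\<forall>d\<in>tangent K. \<forall>f\<in>J. act d f \<in> J)"

text \<open>The operators \<open>act (d z)\<close> are dual to the coordinates only modulo the
  augmentation ideal. Correcting them by an inverse matrix over K makes the duality exact;
  combinations with coefficients in K are still derivations, kill p-th powers and preserve
  tangent-stable ideals.\<close>

lemma tangent_coord:
  assumes K: "subbialg K" and nil: "aug_pow K s = {0}"
  obtains xs \<delta> where "coord M D U E p K xs \<delta> s"
    "\<And>x f. \<exists>c. (\<forall>z. c z \<in> K) \<and> (\<exists>d. (\<forall>z\<in>set xs. d z \<in> tangent K) \<and> \<delta> x f = (\<Sum>z\<in>set xs. c z \<odot> act (d z) f))"
proof -
  have sK: "subalg K" using K by (rule subbialg_subalg)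
  obtain xs d where "cotangent_basis K xs d"
    using cotangent_basis_exists[OF sK] by blast
  then have xs: "distinct xs" "set xs \<subseteq> aug K" and d: "\<And>x. x \<in> set xs \<Longrightarrow> d x \<in> tangent K"
    and dual: "\<And>x y. x \<in> set xs \<Longrightarrow> y \<in> set xs \<Longrightarrow> pairing y (d x) = (if x = y then 1 else 0)"
    and gen: "\<And>f. f \<in> aug K \<Longrightarrow> \<exists>a\<in>fv.span (set xs). f - a \<in> aug_pow K 2"
    unfolding cotangent_basis_def by simp_all
  have xK: "x \<in> K" if "x \<in> set xs" for x using that xs(2) aug_sub by auto
  \<comment> \<open>The error lies in the power with exponent \<open>Suc s\<close>, which vanishes,
    so the inverse is exact.\<close>
  have "\<exists>c. (\<forall>x z. c x z \<in> K) \<and> (\<forall>x\<in>set xs. \<forall>y\<in>set xs.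
      (\<Sum>z\<in>set xs. c x z \<odot> act (d z) y) - (if x = y then E else 0) \<in> aug_pow K (Suc s))"
  proof (rule inverse_matrix_mod_aug_pow[OF sK finite_set])
    fix z y assume "z \<in> set xs" "y \<in> set xs"
    then show "act (d z) y \<in> K" "act (d z) y - (if z = y then E else 0) \<in> aug K"
      using act_in[OF K xK] dual[of z y] by (auto simp: aug_def subalgD[OF sK])
  qed
  then obtain c where c: "\<And>x z. c x z \<in> K" "\<And>x y. x \<in> set xs \<Longrightarrow> y \<in> set xs \<Longrightarrow>
      (\<Sum>z\<in>set xs. c x z \<odot> act (d z) y) - (if x = y then E else 0) \<in> aug_pow K (Suc s)"
    by blast
  have "aug_pow K (Suc s) \<subseteq> {0}" using aug_pow_Suc_sub[OF sK, of s] nil by simp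
  with c(2) have "(\<Sum>z\<in>set xs. c x z \<odot> act (d z) y) - (if x = y then E else 0) = 0"
    if "x \<in> set xs" "y \<in> set xs" for x y
    using that by blast
  then have c2: "(\<Sum>z\<in>set xs. c x z \<odot> act (d z) y) = (if x = y then E else 0)"
    if "x \<in> set xs" "y \<in> set xs" for x y
    using that by (simp only: right_minus_eq)
  define \<delta> where "\<delta> = (\<lambda>x f. \<Sum>z\<in>set xs. c x z \<odot> act (d z) f)"
  show ?thesis
  proof (rule that[of xs \<delta>])
    show "coord M D U E p K xs \<delta> s"
    proof unfold_locales
      show "\<delta> x (f + g) = \<delta> x f + \<delta> x g" "\<delta> x (r \<cdot> f) = r \<cdot> \<delta> x f" for x f g r
        by (simp_all add: \<delta>_def act_simps hmul_add hmul_scl sum.distrib fv.scale_sum_right)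
      show "\<delta> x f \<in> K" if "f \<in> K" for x f
        unfolding \<delta>_def using c(1) act_in[OF K that]
        by (intro fv.subspace_sum subalgD(1)[OF sK] subalgD(3)[OF sK]) auto
      show "\<delta> x (f \<odot> g) = \<delta> x f \<odot> g + f \<odot> \<delta> x g" if "f \<in> K" "g \<in> K" for x f g
      proof -
        have "\<delta> x (f \<odot> g) = (\<Sum>z\<in>set xs. c x z \<odot> act (d z) f \<odot> g + f \<odot> (c x z \<odot> act (d z) g))"
          unfolding \<delta>_def
          by (intro sum.cong refl) (simp add: act_tangent_mul[OF K d that] hmul_add mul_ac)
        then show ?thesis by (simp add: \<delta>_def sum.distrib hmul_sum)
      qed
      show "\<delta> x y = (if x = y then E else 0)" if "x \<in> set xs" "y \<in> set xs" for x y
        unfolding \<delta>_def by (rule c2[OF that])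
      show "\<delta> x f = 0" if "f \<in> frob_img (Suc 0) K" for x f
        unfolding \<delta>_def using act_tangent_frob[OF K d that] by (intro sum.neutral) auto
    qed (fact sK xs gen nil)+
    show "\<exists>c. (\<forall>z. c z \<in> K) \<and> (\<exists>d. (\<forall>z\<in>set xs. d z \<in> tangent K) \<and> \<delta> x f = (\<Sum>z\<in>set xs. c z \<odot> act (d z) f))" for x f
      by (rule exI[of _ "c x"], rule conjI, simp add: c(1), rule exI[of _ d], simp add: \<delta>_def d)
  qed
qed

text \<open>Collects what the inductions use, so that the coordinates can be forgotten. The last
  clause tests an inclusion of tangent-stable ideals on images under T.\<close>

definition frob_retraction :: "('i \<Rightarrow> 'k) set \<Rightarrow> (('i \<Rightarrow> 'k) \<Rightarrow> 'i \<Rightarrow> 'k) \<Rightarrow> bool" where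
  "frob_retraction K T \<longleftrightarrow>
    (\<forall>f g. T (f + g) = T f + T g) \<and> (\<forall>c f. T (c \<cdot> f) = c \<cdot> T f) \<and>
    (\<forall>f\<in>K. T f \<in> frob_img (Suc 0) K) \<and> (\<forall>c\<in>frob_img (Suc 0) K. T c = c) \<and>
    (\<forall>c\<in>frob_img (Suc 0) K. \<forall>f\<in>K. T (c \<odot> f) = c \<odot> T f) \<and>
    (\<forall>N. \<forall>f\<in>aug_pow K N. T f \<in> aug_pow (frob_img (Suc 0) K) ((N + p - 1) div p)) \<and>
    (\<forall>J f. tstable K J \<longrightarrow> f \<in> J \<longrightarrow> T f \<in> J) \<and>
    (\<forall>f\<in>K. (\<forall>d\<in>tangent K. act d f = 0) \<longrightarrow> T f = f) \<and>
    (\<forall>I J. tstable K I \<longrightarrow> tstable K J \<longrightarrow> (\<forall>f\<in>J. T f \<in> I) \<longrightarrow> J \<subseteq> I)"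

lemma frob_retractionD:
  assumes "frob_retraction K T"
  shows "T (f + g) = T f + T g" "T (r \<cdot> f) = r \<cdot> T f"
    "f \<in> K \<Longrightarrow> T f \<in> frob_img (Suc 0) K"
    "c \<in> frob_img (Suc 0) K \<Longrightarrow> T c = c"
    "c \<in> frob_img (Suc 0) K \<Longrightarrow> f \<in> K \<Longrightarrow> T (c \<odot> f) = c \<odot> T f"
    "f \<in> aug_pow K N \<Longrightarrow> T f \<in> aug_pow (frob_img (Suc 0) K) ((N + p - 1) div p)"
    "tstable K J \<Longrightarrow> f \<in> J \<Longrightarrow> T f \<in> J"
    "f \<in> K \<Longrightarrow> (\<And>d. d \<in> tangent K \<Longrightarrow> act d f = 0) \<Longrightarrow> T f = f"
    "tstable K I \<Longrightarrow> tstable K J \<Longrightarrow> (\<And>f. f \<in> J \<Longrightarrow> T f \<in> I) \<Longrightarrow> J \<subseteq> I"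
  using assms unfolding frob_retraction_def by simp_all

lemma frob_retraction_exists:
  assumes K: "subbialg K" and nil: "aug_pow K s = {0}"
  shows "\<exists>T. frob_retraction K T"
proof -
  obtain xs \<delta> where co: "coord M D U E p K xs \<delta> s" and
    \<delta>: "\<And>x f. \<exists>c. (\<forall>z. c z \<in> K) \<and> (\<exists>d. (\<forall>z\<in>set xs. d z \<in> tangent K) \<and> \<delta> x f = (\<Sum>z\<in>set xs. c z \<odot> act (d z) f))"
    using tangent_coord[OF assms] by blast
  interpret C: coord M D U E p K xs \<delta> s by (rule co)
  have in_I: "\<delta> x f \<in> I" if "ideal_of K I" "\<And>d. d \<in> tangent K \<Longrightarrow> act d f \<in> I" for x f I
  proof -
    obtain c d where "\<And>z. c z \<in> K" "\<And>z. z \<in> set xs \<Longrightarrow> d z \<in> tangent K" "\<delta> x f = (\<Sum>z\<in>set xs. c z \<odot> act (d z) f)"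
      using \<delta>[of x f] by blast
    then show ?thesis using that
      by (auto intro!: fv.subspace_sum idlD(1)[OF that(1)] idlD(3)[OF that(1)])
  qed
  have st: "C.stable I" if "tstable K I" for I
    using that in_I by (auto simp: tstable_def C.stable_def)
  \<comment> \<open>For the zero ideal \<open>T_cong\<close> becomes an equality: T fixes what all
    tangent vectors annihilate.\<close>
  have "ideal_of K {0}" by (auto simp: ideal_of_def subalgD[OF C.K])
  then have st0: "tstable K {0}" by (auto simp: tstable_def act_simps)
  have 1: "C.T f = f" if "f \<in> K" "\<forall>d\<in>tangent K. act d f = 0" for f
    using C.T_cong[OF st[OF st0] that(1)] in_I[of "{0}" f] st0 that(2) by (auto simp: tstable_def)
  have 2: "J \<subseteq> I" if "tstable K I" "tstable K J" "\<forall>f\<in>J. C.T f \<in> I" for I J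
    by (rule C.stable_sub[OF st[OF that(1)] st[OF that(2)]]) (rule bspec[OF that(3)])
  have 3: "C.T f \<in> aug_pow (frob_img (Suc 0) K) ((N + p - 1) div p)" if "f \<in> aug_pow K N" for f N
    using C.T_aug_pow[OF that] by (simp add: C.cdiv_def)
  have 4: "C.T f \<in> J" if "tstable K J" "f \<in> J" for f J
    by (rule C.T_stable[OF st[OF that(1)] that(2)])
  have "frob_retraction K C.T"
    unfolding frob_retraction_def
    by (intro conjI allI ballI impI)
      ((rule C.T_lin) | (rule C.T_in, assumption) | (rule C.T_FK, assumption) |
       (rule C.T_FK_mul, assumption, assumption) | (rule 1, assumption, assumption) |
       (rule 2, assumption, assumption, assumption) | (rule 3, assumption) |
       (rule 4, assumption, assumption))+
  then show ?thesis by (intro exI)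
qed

section \<open>Induction along the Frobenius filtration\<close>

text \<open>Because of \<open>Suc n\<close> the generators are p-th powers, hence constants for the
  derivations.\<close>

lemma tstable_frob_ideal:
  assumes K: "subbialg K" shows "tstable K (frob_ideal (Suc n) K)"
  unfolding tstable_def
proof (intro conjI ballI)
  have sK: "subalg K" using K by (rule subbialg_subalg)
  show ideal_of: "ideal_of K (frob_ideal (Suc n) K)" by (rule ideal_of_frob_ideal[OF sK])
  fix d f assume d: "d \<in> tangent K" and f: "f \<in> frob_ideal (Suc n) K"
  have "fv.span {f \<odot> g |f g. f \<in> frob_img (Suc n) (aug K) \<and> g \<in> K} \<subseteq> {f. act d f \<in> frob_ideal (Suc n) K}"
  proof (rule fv.span_minimal)
    show "fv.subspace {f. act d f \<in> frob_ideal (Suc n) K}"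
      using idlD(1)[OF ideal_of] by (simp add: fv.subspace_def act_simps)
    show "{f \<odot> g |f g. f \<in> frob_img (Suc n) (aug K) \<and> g \<in> K} \<subseteq> {f. act d f \<in> frob_ideal (Suc n) K}"
    proof clarify
      fix c g assume c: "c \<in> frob_img (Suc n) (aug K)" and g: "g \<in> K"
      obtain x where x: "x \<in> K" "c = x \<up> (p ^ n * p)"
        using c by (auto simp: frob_img_def aug_def mult.commute)
      then have "c \<in> frob_img (Suc 0) K"
        using subalg_pw[OF sK x(1), of "p ^ n"] by (auto simp: frob_img_def pw_mul)
      then have "act d (c \<odot> g) = c \<odot> act d g"
        using act_tangent_mul[OF K d subsetD[OF frob_img_sub[OF sK]] g] act_tangent_frob[OF K d] by simp
      then show "act d (c \<odot> g) \<in> frob_ideal (Suc n) K"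
        unfolding frob_ideal_def gideal_def using c act_in[OF K g] by (auto intro!: fv.span_base)
    qed
  qed
  then show "act d f \<in> frob_ideal (Suc n) K" using f unfolding frob_ideal_def gideal_def by blast
qed

lemma frob_ideal_0: "subalg K \<Longrightarrow> aug K \<subseteq> frob_ideal 0 K"
proof
  fix f assume "subalg K" "f \<in> aug K"
  then have "\<exists>g h. f = g \<odot> h \<and> g \<in> frob_img 0 (aug K) \<and> h \<in> K"
    by (intro exI[of _ f] exI[of _ E]) (auto simp: frob_img_def subalgD(2))
  then show "f \<in> frob_ideal 0 K"
    unfolding frob_ideal_def gideal_def by (intro fv.span_base CollectI)
qed

lemma frob_ideal_Suc_sub: "subalg K \<Longrightarrow> frob_ideal n (frob_img (Suc 0) K) \<subseteq> frob_ideal (Suc n) K"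
  unfolding frob_ideal_Suc unfolding frob_ideal_def gideal_def
  using frob_img_sub[of K "Suc 0"] by (intro fv.span_mono) blast

text \<open>The hypothesis on \<open>act\<close> says that J is a coideal. For positive n, T maps J
  into its intersection with the Frobenius image, to which the induction hypothesis applies; the
  inclusion lifts back by the last clause of \<open>frob_retraction\<close>.\<close>

lemma coideal_sub_frob_ideal:
  assumes "subbialg K" "aug_pow K s = {0}" "ideal_of K J" "\<And>d f. d \<in> perp J \<Longrightarrow> f \<in> J \<Longrightarrow> act d f \<in> J"
    and "J \<subseteq> aug_pow K (if n = 0 then 1 else p ^ (n - 1) + 1)"
  shows "J \<subseteq> frob_ideal n K"
  using assms
proof (induction n arbitrary: K J)
  case 0
  then show ?case using frob_ideal_0[of K] aug_pow_1[of K] subbialg_subalg[of K] by auto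
next
  case (Suc n)
  note K = \<open>subbialg K\<close> and J = \<open>ideal_of K J\<close>
  have sK: "subalg K" using K by (rule subbialg_subalg)
  let ?L = "frob_img (Suc 0) K"
  have L: "subbialg ?L" "subalg ?L" using subbialg_frob_img[OF K] subalg_frob_img[OF sK] by auto
  obtain T where "frob_retraction K T" using frob_retraction_exists[OF K Suc.prems(2)] by blast
  note T = frob_retractionD[OF this]
  have JN: "J \<subseteq> aug_pow K (p ^ n + 1)" using Suc.prems(5) by simp
  \<comment> \<open>The summand 1 makes the exponent at least 2 even for \<open>n = 0\<close>; hence
    tangent vectors annihilate J, and the coideal property gives stability under them.\<close>
  also have "\<dots> \<subseteq> aug_pow K 2" using p_pos by (intro aug_pow_antimono[OF sK]) (simp add: Suc_leI)
  finally have "tangent K \<subseteq> perp J" using perp_antimono by (auto simp: tangent_def)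
  then have Jst: "tstable K J" using Suc.prems(4) J by (auto simp: tstable_def)
  have TJ: "T f \<in> J \<inter> ?L" if "f \<in> J" for f
    by (rule IntI[OF T(7)[OF Jst that] T(3)[OF subsetD[OF idlD(2)[OF J] that]]])
  have "J \<inter> ?L \<subseteq> frob_ideal n ?L"
  proof (rule Suc.IH[OF L(1)])
    show "aug_pow ?L s = {0}"
      using aug_pow_mono[OF frob_img_sub[OF sK, of "Suc 0"], of s] Suc.prems(2) idlD(5)[OF ideal_of_aug_pow[OF L(2)]] by auto
    show "ideal_of ?L (J \<inter> ?L)"
      unfolding ideal_of_def
    proof (intro conjI ballI)
      fix a f assume "a \<in> ?L" "f \<in> J \<inter> ?L"
      then show "a \<odot> f \<in> J \<inter> ?L"
        using idlD(3)[OF J, of a f] subalgD(3)[OF L(2), of a f] frob_img_sub[OF sK, of "Suc 0"] by blast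
    qed (auto intro: fv.subspace_inter idlD(1)[OF J] subalgD(1)[OF L(2)])
    show "act d f \<in> J \<inter> ?L" if d: "d \<in> perp (J \<inter> ?L)" and f: "f \<in> J \<inter> ?L" for d f
    proof -
      \<comment> \<open>The composite of d with T vanishes on J, since T sends J into
        \<open>J \<inter> ?L\<close>, and agrees with d on \<open>?L\<close>, which T fixes.\<close>
      obtain d' where d': "\<And>f. pairing f d' = pairing (T f) d"
        using adjoint_exists[of T d] T(1,2) by blast
      have "d' \<in> perp J" using d TJ by (simp add: perp_def d')
      moreover have "act d f = act d' f"
        by (rule act_cong[OF L(1)]) (use f d' T(4) in auto)
      moreover have "act d f \<in> ?L" by (rule act_in[OF L(1)]) (use f in blast)
      ultimately show ?thesis using Suc.prems(4)[of d' f] f by simp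
    qed
    show "J \<inter> ?L \<subseteq> aug_pow ?L (if n = 0 then 1 else p ^ (n - 1) + 1)"
    proof
      fix f assume f: "f \<in> J \<inter> ?L"
      then have "f \<in> aug_pow K (p ^ n + 1)" using JN by blast
      from T(6)[OF this] have "f \<in> aug_pow ?L ((p ^ n + 1 + p - 1) div p)" using T(4) f by simp
      \<comment> \<open>For positive n the rounded-up quotient is exactly
        \<open>p ^ (n - 1) + 1\<close>; for \<open>n = 0\<close> it is still at least 1.\<close>
      moreover have "(if n = 0 then 1 else p ^ (n - 1) + 1) \<le> (p ^ n + 1 + p - 1) div p"
        using p_pos by (cases n) (auto simp: Suc_le_eq div_greater_zero_iff)
      ultimately show "f \<in> aug_pow ?L (if n = 0 then 1 else p ^ (n - 1) + 1)"
        using subsetD[OF aug_pow_antimono[OF L(2)]] by blast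
    qed
  qed
  then have "T f \<in> frob_ideal (Suc n) K" if "f \<in> J" for f
    using TJ[OF that] frob_ideal_Suc_sub[OF sK, of n] by blast
  then show ?case by (rule T(9)[OF tstable_frob_ideal[OF K] Jst])
qed

text \<open>The last hypothesis expresses coinvariance modulo the ideal. For positive n it covers
  the tangent vectors, so T fixes f and f lies in the Frobenius image; there the argument repeats
  with n lowered.\<close>

lemma invariant_frob_img:
  assumes "subbialg K" "aug_pow K s = {0}" "f \<in> K"
    and "\<And>h. h \<in> perp (frob_ideal n K) \<Longrightarrow> pairing E h = 0 \<Longrightarrow> act h f = 0"
  shows "f \<in> frob_img n K"
  using assms
proof (induction n arbitrary: K)
  case 0
  then show ?case by (auto simp: frob_img_def)
next
  case (Suc n)
  note K = \<open>subbialg K\<close>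
  have sK: "subalg K" using K by (rule subbialg_subalg)
  let ?L = "frob_img (Suc 0) K"
  have L: "subbialg ?L" "subalg ?L" using subbialg_frob_img[OF K] subalg_frob_img[OF sK] by auto
  obtain T where "frob_retraction K T" using frob_retraction_exists[OF K Suc.prems(2)] by blast
  note T = frob_retractionD[OF this]
  have "act d f = 0" if "d \<in> tangent K" for d
    using Suc.prems(4)[of d] that perp_antimono[OF frob_ideal_tangent[OF sK, of n]] by (auto simp: tangent_def)
  then have "T f = f" by (rule T(8)[OF Suc.prems(3)])
  then have fL: "f \<in> ?L" using T(3)[OF Suc.prems(3)] by simp
  \<comment> \<open>The generators lie in the Frobenius image, over which T is linear, so T only
    moves the cofactor into that image.\<close>
  have TI: "T g \<in> frob_ideal n ?L" if "g \<in> frob_ideal (Suc n) K" for g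
  proof -
    have "fv.span {c \<odot> g |c g. c \<in> frob_img n (aug ?L) \<and> g \<in> K} \<subseteq> {g. T g \<in> frob_ideal n ?L}"
    proof (rule fv.span_minimal)
      show "fv.subspace {g. T g \<in> frob_ideal n ?L}"
        using idlD(1)[OF ideal_of_frob_ideal[OF L(2)]] T(2)[of 0 0] by (simp add: fv.subspace_def T(1,2))
      show "{c \<odot> g |c g. c \<in> frob_img n (aug ?L) \<and> g \<in> K} \<subseteq> {g. T g \<in> frob_ideal n ?L}"
      proof clarify
        fix c g assume c: "c \<in> frob_img n (aug ?L)" and g: "g \<in> K"
        then have "c \<in> ?L" using frob_img_sub[OF L(2), of n] by (auto simp: frob_img_def aug_def)
        then show "T (c \<odot> g) \<in> frob_ideal n ?L"
          unfolding frob_ideal_def gideal_def using c g T(3,5) by (auto intro!: fv.span_base)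
      qed
    qed
    then show ?thesis using that unfolding frob_ideal_Suc gideal_def by blast
  qed
  have "f \<in> frob_img n ?L"
  proof (rule Suc.IH[OF L(1) _ fL])
    show "aug_pow ?L s = {0}"
      using aug_pow_mono[OF frob_img_sub[OF sK, of "Suc 0"], of s] Suc.prems(2) idlD(5)[OF ideal_of_aug_pow[OF L(2)]] by auto
    fix h assume h: "h \<in> perp (frob_ideal n ?L)" "pairing E h = 0"
    obtain h' where h': "\<And>f. pairing f h' = pairing (T f) h"
      using adjoint_exists[of T h] T(1,2) by blast
    have "act h f = act h' f"
      by (rule act_cong[OF L(1) fL]) (use h' T(4) in auto)
    also have "\<dots> = 0"
      using h TI T(4)[OF subalgD(2)[OF L(2)]] by (intro Suc.prems(4)) (auto simp: perp_def h')
    finally show "act h f = 0" .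
  qed
  then show ?case by (simp add: frob_img_Suc[of n])
qed

end

section \<open>The coradical filtration\<close>

lemma dual_basis_expand:
  fixes V :: "('x::finite \<Rightarrow> 'k::field) set"
  assumes V: "fv.subspace V"
  shows "\<exists>B d. B \<subseteq> V \<and> (\<forall>v\<in>V. v = (\<Sum>b\<in>B. pairing v (d b) \<cdot> b))"
proof -
  obtain B where B: "B \<subseteq> V" "fv.independent B" "V \<subseteq> fv.span B"
    using fv.maximal_independent_subset[of V] by blast
  have fB: "finite B" by (rule ffv.finiteI_independent[OF B(2)])
  have "\<exists>h. \<forall>b\<in>B. pairing b h = (if x = b then 1 else 0)" for x
    by (rule pairing_independent_extend[OF B(2)])
  then obtain d where d: "\<And>x b. b \<in> B \<Longrightarrow> pairing b (d x) = (if x = b then 1 else 0)"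
    by metis
  have "fv.span B \<subseteq> {v. v = (\<Sum>b\<in>B. pairing v (d b) \<cdot> b)}"
  proof (rule fv.span_minimal)
    show "fv.subspace {v. v = (\<Sum>b\<in>B. pairing v (d b) \<cdot> b)}"
      unfolding fv.subspace_def mem_Collect_eq
    proof (intro conjI allI ballI impI)
      fix v w assume "v \<in> {v. v = (\<Sum>b\<in>B. pairing v (d b) \<cdot> b)}" "w \<in> {v. v = (\<Sum>b\<in>B. pairing v (d b) \<cdot> b)}"
      then have "v + w = (\<Sum>b\<in>B. pairing v (d b) \<cdot> b) + (\<Sum>b\<in>B. pairing w (d b) \<cdot> b)" by simp
      also have "\<dots> = (\<Sum>b\<in>B. pairing (v + w) (d b) \<cdot> b)"
        by (simp add: fv.scale_left_distrib sum.distrib)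
      finally show "v + w = (\<Sum>b\<in>B. pairing (v + w) (d b) \<cdot> b)" .
    next
      fix c :: 'k and v assume "v \<in> {v. v = (\<Sum>b\<in>B. pairing v (d b) \<cdot> b)}"
      then have "c \<cdot> v = c \<cdot> (\<Sum>b\<in>B. pairing v (d b) \<cdot> b)" by simp
      also have "\<dots> = (\<Sum>b\<in>B. pairing (c \<cdot> v) (d b) \<cdot> b)"
        by (simp add: fv.scale_sum_right)
      finally show "c \<cdot> v = (\<Sum>b\<in>B. pairing (c \<cdot> v) (d b) \<cdot> b)" .
    qed simp
    show "B \<subseteq> {v. v = (\<Sum>b\<in>B. pairing v (d b) \<cdot> b)}"
    proof
      fix b assume b: "b \<in> B"
      have "(\<Sum>x\<in>B. pairing b (d x) \<cdot> x) = (\<Sum>x\<in>B. if x = b then b else 0)"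
        by (intro sum.cong refl) (auto simp: d b)
      then show "b \<in> {v. v = (\<Sum>b\<in>B. pairing v (d b) \<cdot> b)}" using b fB by simp
    qed
  qed
  then have "\<forall>v\<in>V. v = (\<Sum>b\<in>B. pairing v (d b) \<cdot> b)" using B(3) by blast
  with B(1) show ?thesis by blast
qed

lemma tens_eq: "tens V W = fv.span {t2 v w | v w. v \<in> V \<and> w \<in> W}"
  unfolding tens_def lspan_eq t2_def ..

text \<open>Expanding the columns in a basis of V leaves coefficients that are combinations of rows,
  hence in W.\<close>

lemma tensI:
  fixes t :: "'x::finite \<times> 'x \<Rightarrow> 'k::field"
  assumes V: "fv.subspace V" and W: "fv.subspace W"
    and cols: "\<And>c. (\<lambda>a. t (a, c)) \<in> V" and rows: "\<And>a. (\<lambda>c. t (a, c)) \<in> W"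
  shows "t \<in> tens V W"
proof -
  obtain B d where B: "B \<subseteq> V" "\<And>v. v \<in> V \<Longrightarrow> v = (\<Sum>b\<in>B. pairing v (d b) \<cdot> b)"
    using dual_basis_expand[OF V] by blast
  define r where "r = (\<lambda>b. \<Sum>a\<in>UNIV. d b a \<cdot> (\<lambda>c. t (a, c)))"
  have r: "r b \<in> W" for b
    unfolding r_def by (intro fv.subspace_sum fv.subspace_scale W rows)
  have "t = (\<Sum>b\<in>B. t2 b (r b))"
  proof
    fix x :: "'x \<times> 'x"
    obtain a c where x: "x = (a, c)" by fastforce
    have "t x = (\<Sum>b\<in>B. pairing (\<lambda>a. t (a, c)) (d b) \<cdot> b) a"
      using fun_cong[OF B(2)[OF cols], of a c] by (simp add: x)
    also have "\<dots> = (\<Sum>b\<in>B. t2 b (r b)) x"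
      by (simp add: x fun_apply t2_apply r_def pairing_def mult.commute)
    finally show "t x = (\<Sum>b\<in>B. t2 b (r b)) x" .
  qed
  also have "\<dots> \<in> tens V W"
    unfolding tens_eq using B(1) r by (intro fv.span_sum fv.span_base) auto
  finally show ?thesis .
qed

lemma pairing_t2: "pairing (t2 f g) (t2 v w) = pairing f v * pairing g w"
  by (simp add: pairing_def sum_UNIV_pair t2_apply sum_product mult_ac)

lemma pairing_tens_zero:
  assumes "t \<in> tens V W" "\<And>v w. v \<in> V \<Longrightarrow> w \<in> W \<Longrightarrow> pairing f v = 0 \<or> pairing g w = 0"
  shows "pairing (t2 f g) t = 0"
proof -
  have "pairing t (t2 f g) = 0"
    by (rule pairing_span_zero[OF assms(1)[unfolded tens_eq]])
      (use assms(2) in \<open>auto simp: pairing_t2 pairing_commute[of _ "t2 f g"]\<close>)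
  then show ?thesis by (simp add: pairing_commute)
qed

context cobialg
begin

section \<open>Subcoalgebras of H, ideals of the dual algebra and nilpotence\<close>

lemma hcomul_lin: "hcomul D (x + y) = hcomul D x + hcomul D y" "hcomul D (c \<cdot> x) = c \<cdot> hcomul D x"
  by (auto simp: hcomul_def fun_eq_iff fun_apply sum.distrib algebra_simps sum_distrib_left)

lemma pairing_mul: "pairing (f \<odot> g) x = pairing (t2 f g) (hcomul D x)"
  by (simp add: pairing_hmul_dual pairing_def[of "t2 f g"] sum_UNIV_pair t2_apply hcomul_def)

lemma pairing_unitv_mul: "pairing (unitv a \<odot> g) x = pairing g (\<lambda>c. hcomul D x (a, c))"
proof -
  have "pairing (unitv a \<odot> g) x = (\<Sum>b\<in>UNIV. (if a = b then 1 else 0) * (\<Sum>c\<in>UNIV. g c * hcomul D x (b, c)))"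
    by (simp add: pairing_mul pairing_def[of "t2 _ _"] sum_UNIV_pair t2_apply unitv_apply sum_distrib_left mult.assoc)
  then show ?thesis by (simp add: pairing_def)
qed

lemma hcomul_U: "hcomul D U = t2 U U"
  by (auto simp: hcomul_def t2_def D_U)

text \<open>The ideal property controls the rows of the coproduct of x, read as a matrix;
  cocommutativity makes this matrix symmetric, which covers the columns.\<close>

lemma subcoalg_perp:
  assumes J: "ideal_of UNIV J" shows "subcoalg D (perp J)"
  unfolding subcoalg_def lsubspace_iff
proof (intro conjI ballI perp_subspace tensI)
  have sym: "hcomul D x (a, c) = hcomul D x (c, a)" for x a c
    by (simp add: hcomul_def D_comm)
  fix x assume x: "x \<in> perp J"
  show "(\<lambda>c. hcomul D x (a, c)) \<in> perp J" for a
    using idlD(3)[OF J, of "unitv a"] x by (auto simp: perp_def pairing_unitv_mul[symmetric])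
  then show "(\<lambda>a. hcomul D x (a, c)) \<in> perp J" for c
    by (simp add: sym[of x _ c])
qed

lemma U_nonzero: "U \<noteq> 0"
  using eps_simps(6) unfolding eps_def by (metis pairing_simps(8) zero_neq_one)

lemma subspace_singleton_cases:
  assumes "fv.subspace V" "V \<subseteq> fv.span {v}" shows "V = {0} \<or> V = fv.span {v}"
proof (cases "V = {0}")
  case False
  then obtain x where "x \<in> V" "x \<noteq> 0" using fv.subspace_0[OF assms(1)] by blast
  then obtain c where c: "x = c \<cdot> v" "c \<noteq> 0" using assms(2) by (auto simp: fv.span_singleton)
  have "inverse c \<cdot> x \<in> V" using \<open>x \<in> V\<close> by (rule fv.subspace_scale[OF assms(1)])
  then have "v \<in> V" using c by simp
  then have "fv.span {v} \<subseteq> V" using assms(1) by (intro fv.span_minimal) auto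
  then show ?thesis using assms(2) by blast
qed simp

lemma simple_subcoalg_U: "simple_subcoalg D (fv.span {U})"
  unfolding simple_subcoalg_def subcoalg_def lsubspace_iff
proof (intro conjI ballI allI impI)
  fix x assume "x \<in> fv.span {U}"
  then obtain c where "x = c \<cdot> U" by (auto simp: fv.span_singleton)
  then have "hcomul D x = c \<cdot> t2 U U" by (simp add: hcomul_lin hcomul_U)
  moreover have "t2 U U \<in> tens (fv.span {U}) (fv.span {U})"
    unfolding tens_eq by (intro fv.span_base) (auto intro: fv.span_base)
  ultimately show "hcomul D x \<in> tens (fv.span {U}) (fv.span {U})"
    unfolding tens_eq by (simp add: fv.span_scale)
next
  have "U \<in> fv.span {U}" by (simp add: fv.span_base)
  then show "fv.span {U} \<noteq> {\<lambda>_. 0}" using U_nonzero unfolding zero_fun_def by blast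
next
  fix C assume "(fv.subspace C \<and> (\<forall>x\<in>C. hcomul D x \<in> tens C C)) \<and> C \<subseteq> fv.span {U}"
  then show "C = {\<lambda>_. 0} \<or> C = fv.span {U}"
    using subspace_singleton_cases[of C U] by (simp add: zero_fun_def)
qed simp

lemma simple_subcoalg_exists:
  assumes C: "subcoalg D C" "C \<noteq> {0}"
  shows "\<exists>S. simple_subcoalg D S \<and> S \<subseteq> C"
proof -
  let ?Q = "\<lambda>S. subcoalg D S \<and> S \<noteq> {0} \<and> S \<subseteq> C"
  obtain S where S: "?Q S" "\<And>S'. ?Q S' \<Longrightarrow> fv.dim S \<le> fv.dim S'"
    using ex_has_least_nat[of ?Q C "fv.dim"] C by blast
  have "simple_subcoalg D S"
    unfolding simple_subcoalg_def
  proof (intro conjI allI impI)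
    show "subcoalg D S" "S \<noteq> {\<lambda>_. 0}" using S(1) by (auto simp: zero_fun_def)
    fix S' assume S': "subcoalg D S' \<and> S' \<subseteq> S"
    show "S' = {\<lambda>_. 0} \<or> S' = S"
    proof (cases "S' = {0}")
      case False
      then have "fv.dim S \<le> fv.dim S'" using S S' by blast
      then have "S' = S"
        using S(1) S' by (intro ffv.subspace_dim_equal) (auto simp: subcoalg_def lsubspace_iff)
      then show ?thesis ..
    qed (simp add: zero_fun_def)
  qed
  with S(1) show ?thesis by blast
qed

lemma coradical_eq:
  assumes "connected D" shows "coradical D = fv.span {U}"
proof -
  obtain v where v: "coradical D = fv.span {v}"
    using assms unfolding connected_def lspan_eq by auto
  have "fv.span {U} \<subseteq> coradical D"
    unfolding coradical_def lspan_eq using simple_subcoalg_U fv.span_superset by fastforce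
  then show ?thesis
    using subspace_singleton_cases[of "fv.span {U}" v] U_nonzero fv.span_base[of U "{U}"] v by auto
qed

text \<open>The dual algebra is local: the annihilator of a proper ideal is a nonzero subcoalgebra,
  so it contains a simple one, which can only be the line through \<open>U\<close>.\<close>

lemma proper_ideal_of_aug:
  assumes con: "connected D" and J: "ideal_of UNIV J" "E \<notin> J"
  shows "J \<subseteq> aug UNIV"
proof -
  have "perp J \<noteq> {0}"
  proof
    assume "perp J = {0}"
    then have "perp (perp J) = UNIV" by (auto simp: perp_def)
    then show False using perp_perp[OF idlD(1)[OF J(1)]] J(2) by simp
  qed
  then obtain S where S: "simple_subcoalg D S" "S \<subseteq> perp J"
    using simple_subcoalg_exists[OF subcoalg_perp[OF J(1)]] by blast
  have "S \<subseteq> fv.span {U}"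
    unfolding coradical_eq[OF con, symmetric] coradical_def lspan_eq
    using S(1) fv.span_superset by fastforce
  moreover have "fv.subspace S" "S \<noteq> {0}"
    using S(1) by (auto simp: simple_subcoalg_def subcoalg_def lsubspace_iff zero_fun_def)
  ultimately have "S = fv.span {U}" using subspace_singleton_cases by blast
  then have "U \<in> perp J" using S(2) fv.span_base[of U "{U}"] by blast
  then show ?thesis by (auto simp: perp_def aug_def eps_def)
qed

lemma ideal_of_add_principal:
  assumes W: "ideal_of UNIV W" shows "ideal_of UNIV {w + a \<odot> v | w a. w \<in> W}"
  unfolding ideal_of_def fv.subspace_def
proof (intro conjI ballI allI)
  have "0 = 0 + 0 \<odot> v" by simp
  then show "0 \<in> {w + a \<odot> v | w a. w \<in> W}" using idlD(5)[OF W] by blast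
next
  fix x y assume "x \<in> {w + a \<odot> v | w a. w \<in> W}" "y \<in> {w + a \<odot> v | w a. w \<in> W}"
  then obtain w a w' a' where "x = w + a \<odot> v" "y = w' + a' \<odot> v" "w \<in> W" "w' \<in> W" by blast
  then have "x + y = (w + w') + (a + a') \<odot> v" "w + w' \<in> W"
    using idlD(6)[OF W] by (auto simp: hmul_add)
  then show "x + y \<in> {w + a \<odot> v | w a. w \<in> W}" by blast
next
  fix c x assume "x \<in> {w + a \<odot> v | w a. w \<in> W}"
  then obtain w a where "x = w + a \<odot> v" "w \<in> W" by blast
  then have "c \<cdot> x = c \<cdot> w + (c \<cdot> a) \<odot> v" "c \<cdot> w \<in> W"
    using idlD(8)[OF W] by (auto simp: hmul_scl fv.scale_right_distrib)
  then show "c \<cdot> x \<in> {w + a \<odot> v | w a. w \<in> W}" by blast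
next
  fix b x assume "x \<in> {w + a \<odot> v | w a. w \<in> W}"
  then obtain w a where "x = w + a \<odot> v" "w \<in> W" by blast
  then have "b \<odot> x = b \<odot> w + (b \<odot> a) \<odot> v" "b \<odot> w \<in> W"
    using idlD(3)[OF W UNIV_I] by (auto simp: hmul_add mul_assoc)
  then show "b \<odot> x \<in> {w + a \<odot> v | w a. w \<in> W}" by blast
qed simp

text \<open>The witness is a maximal proper subideal W of V: if some x in the augmentation ideal does not map V into W, then
  by maximality some \<open>E - a \<odot> x\<close> lies in a proper ideal, hence in the augmentation ideal, which is absurd.\<close>

lemma nakayama:
  assumes con: "connected D" and V: "ideal_of UNIV V" "V \<noteq> {0}"
  shows "\<exists>W. fv.subspace W \<and> W \<subset> V \<and> (\<forall>x\<in>aug UNIV. \<forall>v\<in>V. x \<odot> v \<in> W)"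
proof -
  let ?Q = "\<lambda>W. ideal_of UNIV W \<and> W \<subset> V"
  have "?Q {0}" using V idlD(5)[OF V(1)] by (auto simp: ideal_of_def)
  moreover have "\<forall>W. ?Q W \<longrightarrow> fv.dim W < Suc (fv.dim V)"
    using ffv.dim_subset by (auto simp: less_Suc_eq_le psubset_eq)
  ultimately have "\<exists>W. ?Q W \<and> (\<forall>W'. ?Q W' \<longrightarrow> fv.dim W' \<le> fv.dim W)"
    by (rule ex_has_greatest_nat)
  then obtain W where W: "?Q W" "\<And>W'. ?Q W' \<Longrightarrow> fv.dim W' \<le> fv.dim W" by metis
  have iW: "ideal_of UNIV W" using W(1) by (rule conjunct1)
  have max: "{w + a \<odot> v | w a. w \<in> W} = V" if v: "v \<in> V" "v \<notin> W" for v
  proof (rule ccontr)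
    let ?W = "{w + a \<odot> v | w a. w \<in> W}"
    assume ne: "?W \<noteq> V"
    have "?W \<subseteq> V"
    proof clarify
      fix w a assume "w \<in> W"
      then have "w \<in> V" using W(1) by blast
      then show "w + a \<odot> v \<in> V" by (rule idlD(6)[OF V(1) _ idlD(3)[OF V(1) UNIV_I v(1)]])
    qed
    then have "?W \<subset> V" using ne by (rule psubsetI)
    then have "fv.dim ?W \<le> fv.dim W" by (intro W(2) conjI ideal_of_add_principal[OF iW])
    moreover have WW: "W \<subseteq> ?W"
    proof
      fix w assume "w \<in> W"
      moreover have "w = w + 0 \<odot> v" by simp
      ultimately show "w \<in> ?W" by blast
    qed
    ultimately have "W = ?W"
      using idlD(1)[OF iW] idlD(1)[OF ideal_of_add_principal[OF iW]] by (intro ffv.subspace_dim_equal)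
    moreover have "v = 0 + E \<odot> v" by simp
    then have "v \<in> ?W" using idlD(5)[OF iW] by blast
    ultimately show False using v(2) by blast
  qed
  have "x \<odot> v \<in> W" if x: "x \<in> aug UNIV" and v: "v \<in> V" for x v
  proof (rule ccontr)
    assume xv: "x \<odot> v \<notin> W"
    then have vW: "v \<notin> W" using idlD(3)[OF iW UNIV_I, of v x] by (rule contrapos_nn)
    have xvV: "x \<odot> v \<in> V" using idlD(3)[OF V(1) UNIV_I v] .
    have "v \<in> {w + a \<odot> (x \<odot> v) | w a. w \<in> W}" unfolding max[OF xvV xv] by (rule v)
    then obtain w a where w: "v = w + a \<odot> (x \<odot> v)" "w \<in> W" by blast
    have R: "ideal_of UNIV {a. a \<odot> v \<in> W}"
      by (auto simp: ideal_of_def fv.subspace_def hmul_add hmul_scl mul_assoc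
          intro: idlD(5,6,8)[OF iW] idlD(3)[OF iW UNIV_I])
    have "(E - a \<odot> x) \<odot> v = w" using w(1) by (simp add: hmul_diff mul_assoc algebra_simps)
    then have "E - a \<odot> x \<in> {a. a \<odot> v \<in> W}" using w(2) by simp
    then have "eps (E - a \<odot> x) = 0"
      using proper_ideal_of_aug[OF con R] vW by (auto simp: aug_def)
    then show False using x by (simp add: aug_def)
  qed
  then show ?thesis using conjunct2[OF W(1)] idlD(1)[OF iW] by (intro exI[of _ W]) simp
qed

lemma subalg_UNIV: "subalg UNIV"
  by (simp add: subalg_def)

text \<open>By \<open>nakayama\<close> each nonzero power strictly contains the next, and dimensions
  cannot fall forever.\<close>

lemma aug_pow_nilpotent:
  assumes con: "connected D" shows "\<exists>s. aug_pow UNIV s = {0}"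
proof (rule ccontr)
  assume ne: "\<not> (\<exists>s. aug_pow UNIV s = {0})"
  have "fv.dim (aug_pow UNIV (Suc n)) < fv.dim (aug_pow UNIV n)" for n
  proof -
    obtain W where W: "fv.subspace W" "W \<subset> aug_pow UNIV n" "\<forall>x\<in>aug UNIV. \<forall>v\<in>aug_pow UNIV n. x \<odot> v \<in> W"
      using nakayama[OF con ideal_of_aug_pow[OF subalg_UNIV, of n]] ne by blast
    have "aug_pow UNIV (Suc n) \<subseteq> W" unfolding aug_pow.simps using W by (intro fv.span_minimal) auto
    moreover have "fv.dim W < fv.dim (aug_pow UNIV n)"
      using W(1,2) idlD(1)[OF ideal_of_aug_pow[OF subalg_UNIV, of n]]
      by (intro ffv.dim_psubset) (simp add: fv.span_eq_iff[THEN iffD2])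
    ultimately show ?thesis using ffv.dim_subset order.strict_trans1 by blast
  qed
  then have "fv.dim (aug_pow UNIV n) + n \<le> fv.dim (aug_pow UNIV 0)" for n
    by (induction n) (auto simp del: aug_pow.simps simp: Suc_le_eq intro: less_le_trans, meson add_less_mono1 less_le_trans)
  from this[of "Suc (fv.dim (aug_pow UNIV 0))"] show False by simp
qed

text \<open>The shift by one starts at j = 0, where the line through the unit is the annihilator of
  the augmentation ideal.\<close>

lemma corad_eq_perp:
  assumes con: "connected D" shows "corad D j = perp (aug_pow UNIV (Suc j))"
proof (induction j)
  case 0
  have "aug UNIV = perp (fv.span {U})"
    unfolding perp_span by (auto simp: aug_def perp_def eps_def pairing_commute)
  then show ?case
    using perp_perp[of "fv.span {U}"] by (simp add: coradical_eq[OF con] aug_pow_1[OF subalg_UNIV] del: aug_pow.simps)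
next
  case (Suc j)
  show ?case
  proof (intro equalityI subsetI)
    fix x assume "x \<in> corad D (Suc j)"
    then obtain s t where st: "hcomul D x = s + t" "s \<in> tens UNIV (corad D j)" "t \<in> tens (coradical D) UNIV"
      by (auto simp: ssum_def plus_fun_def)
    have "pairing (f \<odot> g) x = 0" if "f \<in> aug UNIV" "g \<in> aug_pow UNIV (Suc j)" for f g
    proof -
      have "pairing (t2 f g) s = 0"
        by (rule pairing_tens_zero[OF st(2)]) (use that in \<open>auto simp: Suc perp_def simp del: aug_pow.simps\<close>)
      moreover have "pairing (t2 f g) t = 0"
        by (rule pairing_tens_zero[OF st(3)])
          (use that in \<open>auto simp: coradical_eq[OF con] fv.span_singleton aug_def eps_def\<close>)
      ultimately show ?thesis by (simp add: pairing_mul st(1))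
    qed
    then show "x \<in> perp (aug_pow UNIV (Suc (Suc j)))"
      unfolding aug_pow.simps(2)[of UNIV "Suc j"] perp_span by (auto simp: perp_def simp del: aug_pow.simps)
  next
    fix x assume x: "x \<in> perp (aug_pow UNIV (Suc (Suc j)))"
    \<comment> \<open>Row a of this tensor pairs with g as x pairs with g times an element of the
      augmentation ideal; subtracting \<open>t2 U x\<close> removes the counit part of the first
      leg.\<close>
    have row: "pairing g (\<lambda>c. (hcomul D x - t2 U x) (a, c)) = pairing ((unitv a - U a \<cdot> E) \<odot> g) x" for g a
      by (simp add: hmul_diff hmul_scl pairing_unitv_mul)
        (simp add: pairing_def fun_apply t2_apply algebra_simps sum_subtractf sum_distrib_left)
    have "hcomul D x - t2 U x \<in> tens UNIV (corad D j)"
    proof (rule tensI)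
      fix a
      have "eps (unitv a) = U a" by (simp add: eps_def)
      then have a: "unitv a - U a \<cdot> E \<in> aug UNIV" by (simp add: aug_def)
      have "pairing ((unitv a - U a \<cdot> E) \<odot> g) x = 0" if "g \<in> aug_pow UNIV (Suc j)" for g
        using x that a unfolding aug_pow.simps(2)[of UNIV "Suc j"] perp_span
        by (auto simp: perp_def simp del: aug_pow.simps)
      then show "(\<lambda>c. (hcomul D x - t2 U x) (a, c)) \<in> corad D j"
        unfolding Suc perp_def mem_Collect_eq row by blast
    qed (auto simp: Suc perp_subspace simp del: aug_pow.simps)
    moreover have "t2 U x \<in> tens (coradical D) UNIV"
      unfolding tens_eq coradical_eq[OF con] by (intro fv.span_base) (auto intro: fv.span_base)
    moreover have "hcomul D x = (\<lambda>i. (hcomul D x - t2 U x) i + t2 U x i)"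
      by (simp add: fun_eq_iff fun_apply)
    ultimately show "x \<in> corad D (Suc j)" unfolding corad.simps ssum_def by blast
  qed
qed

section \<open>Subalgebras of H and contraction of the coproduct\<close>

lemma pairing_hm: 
  assumes "cop f = (\<Sum>a\<in>S. t2 (x a) (y a))"
  shows "pairing f (b \<star> c) = (\<Sum>a\<in>S. pairing (x a) b * pairing (y a) c)"
  unfolding pairing_act[symmetric] act_cop[OF assms] by (simp add: pairing_sum mult.commute)

text \<open>The element of H obtained by evaluating the second leg of the coproduct of b at g.\<close>

definition contr :: "('i \<Rightarrow> 'k) \<Rightarrow> ('i \<Rightarrow> 'k) \<Rightarrow> 'i \<Rightarrow> 'k" where
  "contr g b = (\<lambda>a. pairing (unitv a \<odot> g) b)"

lemma pairing_contr: "pairing f (contr g b) = pairing (f \<odot> g) b"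
proof -
  have "pairing (f \<odot> g) b = pairing ((\<Sum>a\<in>UNIV. f a \<cdot> unitv a) \<odot> g) b"
    using unitv_expand[of f] by simp
  also have "\<dots> = pairing f (contr g b)"
    by (simp add: hmul_sum hmul_scl pairing_sum) (simp add: pairing_def contr_def)
  finally show ?thesis ..
qed

lemma pairing_ext2: "(\<And>f. pairing f x = pairing f y) \<Longrightarrow> x = y"
  using pairing_ext[of x y] by (simp add: pairing_commute)

lemma contr_hm:
  assumes g: "cop g = (\<Sum>i\<in>S. t2 (x i) (y i))"
  shows "contr g (b \<star> c) = (\<Sum>i\<in>S. contr (x i) b \<star> contr (y i) c)"
proof (rule pairing_ext2)
  fix f
  have f: "cop f = (\<Sum>a\<in>UNIV. t2 (act (unitv a) f) (unitv a))" by (rule cop_expand)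
  have "cop (f \<odot> g) = (\<Sum>a\<in>UNIV. \<Sum>i\<in>S. t2 (act (unitv a) f \<odot> x i) (unitv a \<odot> y i))"
    by (simp add: cop_mul f g hmul_sum hmul_msq_t2) (rule sum.swap)
  also have "\<dots> = (\<Sum>z\<in>UNIV \<times> S. t2 (act (unitv (fst z)) f \<odot> x (snd z)) (unitv (fst z) \<odot> y (snd z)))"
    by (simp add: sum.cartesian_product split_beta)
  finally have "pairing (f \<odot> g) (b \<star> c) =
      (\<Sum>z\<in>UNIV \<times> S. pairing (act (unitv (fst z)) f \<odot> x (snd z)) b * pairing (unitv (fst z) \<odot> y (snd z)) c)"
    by (rule pairing_hm)
  also have "\<dots> = (\<Sum>a\<in>UNIV. \<Sum>i\<in>S. pairing (act (unitv a) f) (contr (x i) b) * pairing (unitv a) (contr (y i) c))"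
    by (simp only: sum.cartesian_product case_prod_unfold pairing_contr)
  also have "\<dots> = (\<Sum>i\<in>S. pairing f (contr (x i) b \<star> contr (y i) c))"
    unfolding pairing_hm[OF f] by (rule sum.swap)
  finally show "pairing f (contr g (b \<star> c)) = pairing f (\<Sum>i\<in>S. contr (x i) b \<star> contr (y i) c)"
    by (simp add: pairing_contr pairing_sum)
qed

lemma gen_subalgD:
  "fv.subspace (gen_subalg M U S)" "U \<in> gen_subalg M U S" "S \<subseteq> gen_subalg M U S"
  "x \<in> gen_subalg M U S \<Longrightarrow> y \<in> gen_subalg M U S \<Longrightarrow> x \<star> y \<in> gen_subalg M U S"
  unfolding gen_subalg_def lsubspace_iff by (auto simp: fv.subspace_def)

lemma gen_subalg_least:
  assumes "fv.subspace B" "U \<in> B" "S \<subseteq> B" "\<And>x y. x \<in> B \<Longrightarrow> y \<in> B \<Longrightarrow> x \<star> y \<in> B"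
  shows "gen_subalg M U S \<subseteq> B"
  unfolding gen_subalg_def lsubspace_iff using assms by blast

text \<open>By \<open>contr_hm\<close> closure under contraction passes from generators to products.
  It is a one-sided coideal property of the generated subalgebra, and it makes the annihilator an
  ideal.\<close>

lemma gen_subalg_contr:
  assumes S: "\<And>g b. b \<in> S \<Longrightarrow> contr g b \<in> S"
  shows "b \<in> gen_subalg M U S \<Longrightarrow> contr g b \<in> gen_subalg M U S"
proof -
  let ?B = "gen_subalg M U S"
  let ?C = "{b \<in> ?B. \<forall>g. contr g b \<in> ?B}"
  have lin: "contr g (b + c) = contr g b + contr g c" "contr g (r \<cdot> b) = r \<cdot> contr g b" "contr g 0 = 0" for g b c r
    by (rule pairing_ext2, simp add: pairing_contr)+
  have "?B \<subseteq> ?C"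
  proof (rule gen_subalg_least)
    show "fv.subspace ?C" using gen_subalgD(1)[of S] by (auto simp: fv.subspace_def lin)
    have "contr g U = eps g \<cdot> U" for g
      by (rule pairing_ext2) (simp add: pairing_contr flip: eps_def)
    then show "U \<in> ?C" using gen_subalgD(1,2)[of S] by (auto intro: fv.subspace_scale)
    show "S \<subseteq> ?C" using gen_subalgD(3)[of S] S by blast
    fix b c assume bc: "b \<in> ?C" "c \<in> ?C"
    have "contr g (b \<star> c) \<in> ?B" for g
      unfolding contr_hm[OF cop_expand]
      by (intro fv.subspace_sum gen_subalgD(1,4)) (use bc in auto)
    then show "b \<star> c \<in> ?C" using gen_subalgD(4) bc by blast
  qed
  then show "b \<in> ?B \<Longrightarrow> contr g b \<in> ?B" by blast
qed

lemma frob_pn_add: "(x + y) \<up> (p ^ n) = x \<up> (p ^ n) + y \<up> (p ^ n)"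
proof (induction n arbitrary: x y)
  case (Suc n)
  have "z \<up> (p ^ Suc n) = (z \<up> p) \<up> (p ^ n)" for z by (simp add: pw_mul)
  then show ?case by (simp add: frob_p_add Suc)
qed simp

lemma cop_frob_pn:
  "cop f = (\<Sum>a\<in>S. t2 (x a) (y a)) \<Longrightarrow> cop (f \<up> (p ^ n)) = (\<Sum>a\<in>S. t2 (x a \<up> (p ^ n)) (y a \<up> (p ^ n)))"
proof (induction n arbitrary: f x y)
  case (Suc n)
  have "z \<up> (p ^ Suc n) = (z \<up> p) \<up> (p ^ n)" for z by (simp add: pw_mul)
  then show ?case using Suc.IH[OF cop_frob[OF Suc.prems]] by simp
qed simp

text \<open>Modulo the ideal, the power \<open>f \<up> (p ^ n)\<close> is the scalar \<open>eps f ^ (p ^ n)\<close>.\<close>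

lemma frob_mul_pairing:
  assumes "y \<in> perp (frob_ideal n UNIV)"
  shows "pairing (f \<up> (p ^ n) \<odot> g) y = eps (f \<up> (p ^ n)) * pairing g y"
proof -
  let ?f = "f - eps f \<cdot> E"
  have "?f \<in> aug UNIV" by (simp add: aug_def)
  then have "?f \<up> (p ^ n) \<odot> g \<in> frob_ideal n UNIV"
    unfolding frob_ideal_def gideal_def frob_img_def by (intro fv.span_base) blast
  then have 0: "pairing (?f \<up> (p ^ n) \<odot> g) y = 0" using assms by (simp add: perp_def)
  have "f \<up> (p ^ n) = (?f + eps f \<cdot> E) \<up> (p ^ n)" by simp
  also have "\<dots> = ?f \<up> (p ^ n) + eps f ^ (p ^ n) \<cdot> E"
    unfolding frob_pn_add pw_scl pw_unit ..
  finally have "f \<up> (p ^ n) \<odot> g = ?f \<up> (p ^ n) \<odot> g + eps f ^ (p ^ n) \<cdot> g"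
    by (simp only: hmul_add hmul_scl mul_unit)
  then show ?thesis using 0 by simp
qed

text \<open>Dually, the ideal is a coideal. The \<open>p ^ n\<close>-th powers in both legs act as
  scalars by \<open>frob_mul_pairing\<close>, and the sum of the products of these scalars is the
  counit of the generator, which is 0.\<close>

lemma frob_ideal_perp_hm:
  assumes x: "x \<in> perp (frob_ideal n UNIV)" and y: "y \<in> perp (frob_ideal n UNIV)"
  shows "x \<star> y \<in> perp (frob_ideal n UNIV)"
  unfolding frob_ideal_def gideal_def perp_span
proof -
  have "pairing (f \<up> (p ^ n) \<odot> g) (x \<star> y) = 0" if f: "eps f = 0" for f g
  proof -
    let ?v = "\<lambda>a. act (unitv a) f \<up> (p ^ n)" and ?w = "\<lambda>a. unitv a \<up> (p ^ n)"
    let ?c = "\<lambda>a. act (unitv a) g"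
    have F: "cop (f \<up> (p ^ n)) = (\<Sum>a\<in>UNIV. t2 (?v a) (?w a))"
      by (rule cop_frob_pn[OF cop_expand])
    have "0 = eps (f \<up> (p ^ n))" using f p_pos by simp
    also have "\<dots> = pairing (f \<up> (p ^ n)) (U \<star> U)" by (simp add: eps_def)
    also have "\<dots> = (\<Sum>a\<in>UNIV. eps (?v a) * eps (?w a))"
      unfolding pairing_hm[OF F] eps_def ..
    finally have z: "(\<Sum>a\<in>UNIV. eps (?v a) * eps (?w a)) = 0" ..
    have "cop (f \<up> (p ^ n) \<odot> g) = (\<Sum>a\<in>UNIV. \<Sum>b\<in>UNIV. t2 (?v a \<odot> ?c b) (?w a \<odot> unitv b))"
      by (simp add: cop_mul F cop_expand[of g] hmul_sum hmul_msq_t2) (rule sum.swap)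
    also have "\<dots> = (\<Sum>s\<in>UNIV. t2 (?v (fst s) \<odot> ?c (snd s)) (?w (fst s) \<odot> unitv (snd s)))"
      by (simp add: sum_UNIV_pair)
    finally have "pairing (f \<up> (p ^ n) \<odot> g) (x \<star> y) =
        (\<Sum>s\<in>UNIV. pairing (?v (fst s) \<odot> ?c (snd s)) x * pairing (?w (fst s) \<odot> unitv (snd s)) y)"
      by (rule pairing_hm)
    also have "\<dots> = (\<Sum>s\<in>UNIV. (eps (?v (fst s)) * eps (?w (fst s))) * (pairing (?c (snd s)) x * pairing (unitv (snd s)) y))"
      unfolding frob_mul_pairing[OF x] frob_mul_pairing[OF y] by (simp only: mult_ac)
    also have "\<dots> = (\<Sum>a\<in>UNIV. eps (?v a) * eps (?w a)) * (\<Sum>b\<in>UNIV. pairing (?c b) x * pairing (unitv b) y)"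
      by (rule sum_UNIV_prod)
    finally show ?thesis unfolding z by simp
  qed
  then show "x \<star> y \<in> perp {f \<odot> g |f g. f \<in> frob_img n (aug UNIV) \<and> g \<in> UNIV}"
    by (auto simp: perp_def frob_img_def aug_def)
qed

text \<open>For positive n, the right-hand side is a subalgebra containing the generators. For the
  other inclusion, the annihilator of the generated subalgebra is an ideal and a coideal inside the
  power that \<open>coideal_sub_frob_ideal\<close> requires.\<close>

lemma upper_ps_eq_perp:
  assumes con: "connected D"
  shows "upper_ps M U D p n = perp (frob_ideal n UNIV)"
proof (cases n)
  case 0
  have "frob_ideal 0 UNIV = aug UNIV"
    using frob_ideal_0[OF subalg_UNIV] frob_ideal_sub[OF subalg_UNIV ideal_of_aug[OF subalg_UNIV], of 0] by auto
  then show ?thesis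
    using corad_eq_perp[OF con, of 0]
    by (simp add: 0 upper_ps_def lspan_eq aug_pow_1[OF subalg_UNIV] coradical_eq[OF con] del: aug_pow.simps)
next
  case (Suc m)
  let ?B = "gen_subalg M U (corad D (p ^ m))" and ?I = "frob_ideal n UNIV"
  obtain s where s: "aug_pow UNIV s = {0}" using aug_pow_nilpotent[OF con] by blast
  have corad: "corad D (p ^ m) = perp (aug_pow UNIV (p ^ m + 1))" using corad_eq_perp[OF con] by simp
  have aug_pow: "ideal_of UNIV (aug_pow UNIV N)" for N by (rule ideal_of_aug_pow[OF subalg_UNIV])
  \<comment> \<open>The ideal must lie in the power annihilating \<open>corad D (p ^ m)\<close>;
    this is where p being at least 2 enters.\<close>
  have "p ^ m + 1 \<le> p ^ m * 2" using p_pos by (simp add: Suc_leI)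
  also have "\<dots> \<le> p ^ m * p" using prime_ge_2_nat[OF prime_p] by (rule mult_le_mono2)
  finally have "p ^ m + 1 \<le> p ^ n" by (simp add: Suc mult.commute)
  then have I: "?I \<subseteq> aug_pow UNIV (p ^ m + 1)" by (rule frob_ideal_aug_pow[OF subalg_UNIV])
  also have "\<dots> \<subseteq> aug UNIV"
    using aug_pow_antimono[OF subalg_UNIV, of "Suc 0" "p ^ m + 1"] aug_pow_1[OF subalg_UNIV] by (simp del: aug_pow.simps)
  finally have "U \<in> perp ?I" by (auto simp: perp_def aug_def eps_def)
  then have 1: "?B \<subseteq> perp ?I"
    using perp_antimono[OF I] frob_ideal_perp_hm by (intro gen_subalg_least perp_subspace) (auto simp: corad)
  have "contr g b \<in> corad D (p ^ m)" if "b \<in> corad D (p ^ m)" for g b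
    using that idlD(4)[OF aug_pow UNIV_I] by (auto simp: corad perp_def pairing_contr simp del: aug_pow.simps)
  from gen_subalg_contr[OF this] have contr: "b \<in> ?B \<Longrightarrow> contr g b \<in> ?B" for g b .
  have pp: "perp (perp ?B) = ?B" by (rule perp_perp[OF gen_subalgD(1)])
  have "perp ?B \<subseteq> ?I"
  proof (rule coideal_sub_frob_ideal[OF subbialg_UNIV s])
    show "ideal_of UNIV (perp ?B)"
      unfolding ideal_of_def
    proof (intro conjI ballI perp_subspace)
      fix a f assume f: "f \<in> perp ?B"
      have "pairing b (f \<odot> a) = 0" if "b \<in> ?B" for b
      proof -
        have "pairing b (f \<odot> a) = pairing (contr a b) f"
          unfolding pairing_commute[of b] pairing_contr[symmetric] by (rule pairing_commute)
        then show ?thesis using contr[OF that, of a] f by (simp add: perp_def)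
      qed
      then show "a \<odot> f \<in> perp ?B" by (simp add: perp_def mul_comm[of a])
    qed simp
    show "act d f \<in> perp ?B" if "d \<in> perp (perp ?B)" "f \<in> perp ?B" for d f
      unfolding perp_def
    proof (intro CollectI ballI)
      fix b assume "b \<in> ?B"
      then have "b \<star> d \<in> ?B" using that(1) gen_subalgD(4) unfolding pp by blast
      then have "pairing (b \<star> d) f = 0" using that(2) by (simp add: perp_def)
      then show "pairing b (act d f) = 0" using pairing_act[of d f b] by (simp add: pairing_commute)
    qed
    have "perp ?B \<subseteq> perp (corad D (p ^ m))" by (rule perp_antimono[OF gen_subalgD(3)])
    then show "perp ?B \<subseteq> aug_pow UNIV (if n = 0 then 1 else p ^ (n - 1) + 1)"
      unfolding corad perp_perp[OF idlD(1)[OF aug_pow]] by (simp add: Suc)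
  qed
  from perp_antimono[OF this] have "perp ?I \<subseteq> ?B" unfolding pp .
  with 1 show ?thesis by (simp add: upper_ps_def Suc)
qed

section \<open>The two duality identities\<close>

lemma lower_ps_eq: "lower_ps (dual_mult D) E p n = frob_img n UNIV"
  by (auto simp: lower_ps_def frob_img_def)

lemma dual_quot_eq_perp:
  "dual_quot (dual_mult D) U (lower_ps (dual_mult D) E p n) = perp (frob_ideal n UNIV)"
proof -
  have "hcounit U y = eps y" for y by (simp add: hcounit_def eps_def pairing_def)
  then have "{l \<odot> y | l y. y \<in> lower_ps (dual_mult D) E p n \<and> hcounit U y = 0} =
      {f \<odot> g | f g. f \<in> aug (frob_img n UNIV) \<and> g \<in> UNIV}"
    unfolding lower_ps_eq by (auto simp: aug_def) (use mul_comm in blast)+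
  then show ?thesis
    by (simp add: dual_quot_def perp_def frob_ideal_def gideal_def lspan_eq aug_frob_img)
qed

text \<open>Vanishing of f on all products \<open>l \<star> y\<close> means, by adjointness, that
  \<open>act y f\<close> is 0, so \<open>invariant_frob_img\<close> applies. Conversely the legs of
  the coproduct of a \<open>p ^ n\<close>-th power are again such powers, on which the elements y in
  question vanish.\<close>

lemma dual_quot_perp_eq:
  assumes con: "connected D"
  shows "dual_quot M E (perp (frob_ideal n UNIV)) = frob_img n UNIV"
proof -
  let ?S = "{l \<star> y | l y. y \<in> perp (frob_ideal n UNIV) \<and> hcounit E y = 0}"
  have "dual_quot M E (perp (frob_ideal n UNIV)) = perp (fv.span ?S)"
    by (simp add: dual_quot_def perp_def lspan_eq)
  also have "\<dots> = perp ?S" by (rule perp_span)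
  also have "\<dots> = frob_img n UNIV"
  proof (intro equalityI subsetI)
    fix f assume f: "f \<in> perp ?S"
    obtain s where s: "aug_pow UNIV s = {0}" using aug_pow_nilpotent[OF con] by blast
    show "f \<in> frob_img n UNIV"
    proof (rule invariant_frob_img[OF subbialg_UNIV s])
      fix h assume h: "h \<in> perp (frob_ideal n UNIV)" "pairing E h = 0"
      have "hcounit E h = 0" using h(2) by (simp add: hcounit_def pairing_def mult.commute)
      then have "pairing f (l \<star> h) = 0" for l
        using f h(1) unfolding perp_def by (auto simp: pairing_commute[of f])
      then show "act h f = 0" by (intro pairing_ext) (simp add: pairing_act)
    qed simp
  next
    fix f assume "f \<in> frob_img n UNIV"
    then obtain g where g: "f = g \<up> (p ^ n)" by (auto simp: frob_img_def)
    have "pairing (l \<star> y) f = 0" if y: "y \<in> perp (frob_ideal n UNIV)" "hcounit E y = 0" for l y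
    proof -
      have "pairing E y = 0" using y(2) by (simp add: hcounit_def pairing_def mult.commute)
      then have "pairing (w \<up> (p ^ n)) y = 0" for w
        using frob_mul_pairing[OF y(1), of w E] by simp
      then have "pairing f (l \<star> y) = 0"
        unfolding g pairing_hm[OF cop_frob_pn[OF cop_expand]] by simp
      then show ?thesis by (simp add: pairing_commute)
    qed
    then show "f \<in> perp ?S" by (auto simp: perp_def)
  qed
  finally show ?thesis .
qed

end

lemma cobialgI:
  fixes M D :: "'i::finite \<Rightarrow> 'i \<Rightarrow> 'i \<Rightarrow> 'k::alg_closed_field"
  assumes "CHAR('k) = p" "p > 0" "hopf_sc M U D E A" "cocommutative D"
  shows "cobialg M D U E p"
  using assms unfolding cobialg_def hopf_sc_def cocommutative_def
  by (elim conjE) (intro conjI; assumption)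

theorem theorem4p1:
  fixes M D :: "'i::finite \<Rightarrow> 'i \<Rightarrow> 'i \<Rightarrow> 'k::alg_closed_field"
    and U E :: "'i \<Rightarrow> 'k"
    and A :: "'i \<Rightarrow> 'i \<Rightarrow> 'k"
    and p n :: nat
  assumes "CHAR('k) = p" and "p > 0"
    and "hopf_sc M U D E A"
    and "cocommutative D"
    and "connected D"
  shows "upper_ps M U D p n = dual_quot (dual_mult D) U (lower_ps (dual_mult D) E p n)
       \<and> lower_ps (dual_mult D) E p n = dual_quot M E (upper_ps M U D p n)"
proof -
  interpret cobialg M D U E p by (rule cobialgI[OF assms(1-4)])
  show ?thesis
    by (simp add: upper_ps_eq_perp[OF assms(5)] dual_quot_perp_eq[OF assms(5)] lower_ps_eq
        dual_quot_eq_perp[unfolded lower_ps_eq])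
qed

end
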